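(* Let $a$ and $b$ be even integers with $4 \le a \le b$. Let $G$ be a finite simple graph on $n$ vertices such that (i) $\kappa(G) \ge a$, (ii) $n \ge 2a + b + \frac{a^2 - 3a}{b} - 2$, and (iii) $\delta(G) \ge \frac{an}{a+b}$. Then $G$ contains an even $[a,b]$-factor.
   Context: An even $[a,b]$-factor of a graph $G$ is a spanning subgraph $H$ such that for every vertex $v \in V(G)$, $d_H(v)$ is even and $a \le d_H(v) \le b$. $\kappa(G)$ denotes the vertex-connectivity of $G$: the largest $k$ such that $|V(G)| \ge k+1$ and $G - S$ is connected for every $S \subseteq V(G)$ with $|S| < k$. $\delta(G)$ is the minimum degree of $G$. *)

theory Defs
  imports Complex_Main "Graph_Theory.Graph_Theory"
begin

text \<open>
  A finite simple graph is a digraph satisfying the locale predicate \<^const>\<open>graph\<close>: finite, without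
  loops or parallel arcs, and symmetric. Each undirected edge \<open>uv\<close> is a pair of opposite arcs, so the
  degree of a vertex in the undirected sense is its \<^const>\<open>out_degree\<close>.
\<close>

definition min_degree :: "('a, 'b) pre_digraph \<Rightarrow> nat" where
  "min_degree G = Min (out_degree G ` verts G)"

text \<open>
  For a finite nonempty graph the set below contains 0 and is bounded, so the supremum is its
  largest element. \<open>G - S\<close> is the subgraph induced on the remaining vertices.
  \<^const>\<open>Digraph_Component.connected\<close> is written qualified because \<open>connected\<close> also names the
  topological notion.
\<close>

definition vertex_connectivity :: "('a, 'b) pre_digraph \<Rightarrow> nat" where
  "vertex_connectivity G =
    Sup {k. card (verts G) \<ge> k + 1 \<and>
      (\<forall>S \<subseteq> verts G. card S < k \<longrightarrow> Digraph_Component.connected (G \<restriction> (verts G - S)))}"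

text \<open>
  \<^term>\<open>spanning H G\<close> alone would admit an asymmetric set of arcs; \<^term>\<open>graph H\<close> ensures that
  the arcs of \<open>H\<close> again form undirected edges.
\<close>

definition even_factor :: "nat \<Rightarrow> nat \<Rightarrow> ('a, 'b) pre_digraph \<Rightarrow> ('a, 'b) pre_digraph \<Rightarrow> bool" where
  "even_factor a b H G \<longleftrightarrow>
    graph H \<and> spanning H G \<and>
    (\<forall>v \<in> verts G. even (out_degree H v) \<and> a \<le> out_degree H v \<and> out_degree H v \<le> b)"

end

theory Submission
  imports Defs
begin

text \<open>
  Attach \<open>(b - a) / 2\<close> loops to every vertex of \<open>G\<close>: an even \<open>[a, b]\<close>-factor of \<open>G\<close> is the same as a
  subgraph of the enlarged multigraph in which every vertex has degree exactly \<open>b\<close>. By Tutte's gadget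
  such a subgraph is a perfect matching of an auxiliary graph, and a Tutte barrier there becomes a
  pair of disjoint vertex sets \<open>S\<close>, \<open>T\<close> with \<open>b |S| - a |T| + \<Sum>\<^bsub>v \<in> T\<^esub> d\<^bsub>G - S\<^esub>(v) - q \<le> -2\<close>, where \<open>q\<close> counts
  pieces of \<open>G - S - T\<close> sending an odd number of edges to \<open>T\<close>. Let \<open>h\<close> be the minimum of \<open>d\<^bsub>G - S\<^esub>\<close>
  on \<open>T\<close>, so that \<open>\<delta>(G) \<le> h + |S|\<close>. If \<open>h < a\<close>, the bounds on \<open>\<delta>(G)\<close> and \<open>n\<close> contradict the barrier
  inequality. If \<open>h \<ge> a\<close>, then \<open>q \<ge> 2\<close>, so by connectivity every piece sends at least \<open>a - |S|\<close> edges
  to \<open>T\<close>, which makes \<open>T\<close> too large.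
\<close>

section \<open>The theorems of Hall and Tutte\<close>

text \<open>Induction on \<open>card X\<close>. If some nonempty proper \<open>Y\<close> is tight,
  \<open>Y\<close> is matched into its neighbours and the rest avoids them; otherwise every nonempty
  proper subset has a spare neighbour, so any one pair can be split off.\<close>

theorem hall_marriage:
  fixes N :: "'a \<Rightarrow> 'b set"
  assumes "finite X" and "\<And>x. x \<in> X \<Longrightarrow> finite (N x)"
    and "\<And>Y. Y \<subseteq> X \<Longrightarrow> card Y \<le> card (\<Union> (N ` Y))"
  shows "\<exists>f. inj_on f X \<and> (\<forall>x\<in>X. f x \<in> N x)"
  using assms
proof (induction "card X" arbitrary: X N rule: less_induct)
  case less
  note fX = less.prems(1) and fN = less.prems(2) and hall = less.prems(3)
  show ?case
  proof (cases "\<exists>Y. Y \<noteq> {} \<and> Y \<subset> X \<and> card Y = card (\<Union> (N ` Y))")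
    case True
    then obtain Y where Y: "Y \<noteq> {}" "Y \<subset> X" "card Y = card (\<Union> (N ` Y))" by blast
    have fY: "finite Y" using Y(2) fX finite_subset by blast
    have fNY: "finite (\<Union> (N ` Y))" using fY fN Y(2) by blast
    have "\<exists>f. inj_on f Y \<and> (\<forall>x\<in>Y. f x \<in> N x)"
    proof (rule less.hyps)
      show "card Y < card X" using psubset_card_mono[OF fX Y(2)] .
      show "finite Y" by (rule fY)
      show "finite (N x)" if "x \<in> Y" for x using fN that Y(2) by blast
      show "card Z \<le> card (\<Union> (N ` Z))" if "Z \<subseteq> Y" for Z using hall that Y(2) by blast
    qed
    then obtain f where f: "inj_on f Y" "\<forall>x\<in>Y. f x \<in> N x" by blast
    define N' where "N' = (\<lambda>x. N x - \<Union> (N ` Y))"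
    have "\<exists>g. inj_on g (X - Y) \<and> (\<forall>x\<in>X - Y. g x \<in> N' x)"
    proof (rule less.hyps)
      show "card (X - Y) < card X"
        using Y fX by (intro psubset_card_mono) auto
      fix Z assume Z: "Z \<subseteq> X - Y"
      have fZ: "finite Z" using Z fX finite_subset by blast
      \<comment> \<open>Hall's condition for \<open>Z \<union> Y\<close>, minus the neighbours of
        the tight set \<open>Y\<close>, is Hall's condition for \<open>N'\<close> on
        \<open>Z\<close>.\<close>
      have "card Z + card Y = card (Z \<union> Y)"
        using Z fZ fY by (subst card_Un_disjoint) auto
      also have "\<dots> \<le> card (\<Union> (N ` (Z \<union> Y)))"
        using hall[of "Z \<union> Y"] Z Y by blast
      also have "\<Union> (N ` (Z \<union> Y)) = \<Union> (N' ` Z) \<union> \<Union> (N ` Y)"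
        by (auto simp: N'_def)
      also have "card \<dots> = card (\<Union> (N' ` Z)) + card (\<Union> (N ` Y))"
        using fNY fZ Z fN by (intro card_Un_disjoint) (auto simp: N'_def)
      finally show "card Z \<le> card (\<Union> (N' ` Z))" using Y(3) by simp
    qed (use fX fN in \<open>auto simp: N'_def\<close>)
    then obtain g where g: "inj_on g (X - Y)" "\<forall>x\<in>X - Y. g x \<in> N' x" by blast
    have "inj_on (\<lambda>x. if x \<in> Y then f x else g x) X"
    proof (rule inj_onI)
      fix x y
      assume xy: "x \<in> X" "y \<in> X" "(if x \<in> Y then f x else g x) = (if y \<in> Y then f y else g y)"
      have ne: "g u \<noteq> f w" if "u \<in> X - Y" "w \<in> Y" for u w
      proof
        assume "g u = f w"
        moreover have "f w \<in> \<Union> (N ` Y)" using f(2) that(2) by blast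
        moreover have "g u \<in> N' u" using g(2) that(1) by blast
        ultimately show False by (simp add: N'_def)
      qed
      then show "x = y"
        using xy f(1) g(1) ne ne[symmetric]
        by (cases "x \<in> Y"; cases "y \<in> Y") (auto dest: inj_onD)
    qed
    moreover have "\<forall>x\<in>X. (if x \<in> Y then f x else g x) \<in> N x"
      using f(2) g(2) by (auto simp: N'_def)
    ultimately show ?thesis by blast
  next
    case False
    show ?thesis
    proof (cases "X = {}")
      case True
      then show ?thesis by simp
    next
      case nonempty: False
      then obtain x where x: "x \<in> X" by blast
      have "N x \<noteq> {}" using hall[of "{x}"] x by auto
      then obtain y where y: "y \<in> N x" by blast
      define N' where "N' = (\<lambda>z. N z - {y})"
      have "\<exists>g. inj_on g (X - {x}) \<and> (\<forall>z\<in>X - {x}. g z \<in> N' z)"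
      proof (rule less.hyps)
        show "card (X - {x}) < card X"
          using x fX by (intro psubset_card_mono) auto
        fix Z assume Z: "Z \<subseteq> X - {x}"
        have fZ: "finite Z" using Z fX finite_subset by blast
        have fNZ: "finite (\<Union> (N ` Z))" using fZ Z fN by blast
        show "card Z \<le> card (\<Union> (N' ` Z))"
        proof (cases "Z = {}")
          case nz: False
          \<comment> \<open>Without tight proper subsets the inequality is strict, which pays for
            the loss of \<open>y\<close>.\<close>
          have "card Z \<noteq> card (\<Union> (N ` Z))" using False nz Z x by blast
          moreover have "card Z \<le> card (\<Union> (N ` Z))" using hall Z by blast
          moreover have "\<Union> (N' ` Z) = \<Union> (N ` Z) - {y}" by (auto simp: N'_def)
          moreover have "card (\<Union> (N ` Z)) \<le> Suc (card (\<Union> (N ` Z) - {y}))"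
            using fNZ diff_card_le_card_Diff[of "{y}" "\<Union> (N ` Z)"] by simp
          ultimately show ?thesis by simp
        qed simp
      qed (use fX fN in \<open>auto simp: N'_def\<close>)
      then obtain g where g: "inj_on g (X - {x})" "\<forall>z\<in>X - {x}. g z \<in> N' z" by blast
      have "inj_on (g(x := y)) (insert x (X - {x}))"
        using g by (auto simp: inj_on_def N'_def)
      moreover have "insert x (X - {x}) = X" using x by blast
      moreover have "\<forall>z\<in>X. (g(x := y)) z \<in> N z" using g(2) y by (auto simp: N'_def)
      ultimately show ?thesis by metis
    qed
  qed
qed

text \<open>
  Families of disjoint odd sets without edges leaving them inside \<open>W\<close> replace the odd components of the
  graph induced on \<open>W\<close>; no connectivity of the members is needed, which allows merging and splitting
  them freely.
\<close>

definition odd_family :: "('a \<Rightarrow> 'a \<Rightarrow> bool) \<Rightarrow> 'a set \<Rightarrow> 'a set set \<Rightarrow> bool" where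
  "odd_family E W \<K> \<longleftrightarrow> pairwise disjnt \<K> \<and>
    (\<forall>K\<in>\<K>. K \<subseteq> W \<and> odd (card K) \<and> (\<forall>x\<in>K. \<forall>y\<in>W - K. \<not> E x y))"

lemma finite_odd_family:
  assumes "finite W" and "odd_family E W \<K>"
  shows "finite \<K>"
proof (rule finite_subset)
  show "\<K> \<subseteq> Pow W" using assms(2) unfolding odd_family_def by blast
qed (use assms(1) in simp)

text \<open>By parity the uncovered rest of \<open>W\<close> is odd; the members are closed and
  \<open>E\<close> is symmetric, so no edge leaves that rest and it can join the family.\<close>

lemma odd_family_augment:
  assumes "finite W" and "symp E" and fam: "odd_family E W \<K>" and "odd (card W + card \<K>)"
  shows "\<exists>\<L>. odd_family E W \<L> \<and> card \<L> = Suc (card \<K>)"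
proof -
  define R where "R = W - \<Union> \<K>"
  have subW: "\<Union> \<K> \<subseteq> W" using fam unfolding odd_family_def by blast
  have f\<K>: "finite \<K>" using finite_odd_family[OF assms(1) fam] .
  have fin: "finite K" if "K \<in> \<K>" for K
    using subW that assms(1) by (meson Union_upper finite_subset)
  have oddK: "{K \<in> \<K>. odd (card K)} = \<K>" using fam unfolding odd_family_def by blast
  have "card (\<Union> \<K>) = (\<Sum>K\<in>\<K>. card K)"
    using fam fin unfolding odd_family_def by (intro card_Union_disjoint) auto
  also have "even \<dots> \<longleftrightarrow> even (card \<K>)"
    using even_sum_iff[OF f\<K>, of card] oddK by simp
  finally have "even (card (\<Union> \<K>)) \<longleftrightarrow> even (card \<K>)" .
  moreover have "card W = card R + card (\<Union> \<K>)"
    unfolding R_def using subW assms(1) by (metis card_Diff_subset card_mono finite_subset le_add_diff_inverse2)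
  ultimately have oddR: "odd (card R)" using assms(4) by presburger
  then have "R \<noteq> {}" by auto
  then have "R \<notin> \<K>" unfolding R_def by blast
  then have "card (insert R \<K>) = Suc (card \<K>)" using f\<K> by simp
  moreover have "odd_family E W (insert R \<K>)"
    using fam oddR sympD[OF assms(2)] unfolding odd_family_def
    by (fastforce simp: R_def pairwise_insert disjnt_def)
  ultimately show ?thesis by blast
qed

text \<open>
  Take a largest \<open>S\<close> with an odd family of size \<open>|S|\<close>. By maximality the family covers everything outside
  \<open>S\<close>, and each member minus any one of its vertices satisfies the hypothesis again. Hall's theorem
  matches the members into \<open>S\<close>, and the induction hypothesis matches what remains of each of them.
\<close>

theorem tutte_perfect_matching:
  assumes "finite V" and "symp E"
    and "\<And>U \<K>. U \<subseteq> V \<Longrightarrow> odd_family E (V - U) \<K> \<Longrightarrow> card \<K> \<le> card U"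
  shows "\<exists>m. \<forall>v\<in>V. m v \<in> V \<and> m (m v) = v \<and> E v (m v)"
  using assms
proof (induction "card V" arbitrary: V rule: less_induct)
  case less
  note fV = less.prems(1) and tutte = less.prems(3)
  have fam_empty: "odd_family E W {}" for W unfolding odd_family_def by simp
  \<comment> \<open>An odd \<open>V\<close> would give an odd family of size one against
    \<open>U = {}\<close>.\<close>
  have evenV: "even (card V)"
    using odd_family_augment[OF fV assms(2) fam_empty] tutte[of "{}"] by force
  define tight where "tight S \<longleftrightarrow> S \<subseteq> V \<and> (\<exists>\<K>. odd_family E (V - S) \<K> \<and> card \<K> = card S)" for S
  have t0: "tight {}" unfolding tight_def using fam_empty by (intro conjI exI[of _ "{}"]) auto
  have bounded: "\<forall>S. tight S \<longrightarrow> card S < Suc (card V)"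
    using fV by (auto simp: tight_def less_Suc_eq_le card_mono)
  obtain S where S: "tight S" and greatest: "\<forall>S'. tight S' \<longrightarrow> card S' \<le> card S"
    using ex_has_greatest_nat[OF t0 bounded] by (elim exE conjE)
  \<comment> \<open>Above the size of \<open>S\<close> equality would be tight, so Tutte's
    inequality is strict there. Both contradictions below violate this.\<close>
  have maxi: "card \<L> < card U" if "U \<subseteq> V" "odd_family E (V - U) \<L>" "card S < card U" for U \<L>
  proof -
    have "\<not> tight U" using greatest that(3) by force
    then have "card \<L> \<noteq> card U" using that unfolding tight_def by blast
    then show ?thesis using tutte[of U \<L>] that by simp
  qed
  from S obtain \<K> where SV: "S \<subseteq> V" and fam: "odd_family E (V - S) \<K>" and card\<K>: "card \<K> = card S"
    unfolding tight_def by blast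
  have fS: "finite S" using SV fV finite_subset by blast
  have f\<K>: "finite \<K>" using finite_odd_family[OF _ fam] fV by simp
  have disj: "K = L" if "x \<in> K" "x \<in> L" "K \<in> \<K>" "L \<in> \<K>" for x K L
    using fam that unfolding odd_family_def pairwise_def disjnt_def by blast
  have Ksub: "K \<subseteq> V - S" and Kodd: "odd (card K)" and Kclosed: "\<And>x y. x \<in> K \<Longrightarrow> y \<in> V - S - K \<Longrightarrow> \<not> E x y"
    if "K \<in> \<K>" for K using fam that unfolding odd_family_def by blast+
  have fK: "finite K" if "K \<in> \<K>" for K using Ksub[OF that] fV finite_subset by blast

  \<comment> \<open>Moving an uncovered \<open>v\<close> into \<open>S\<close> flips the parity of
    the ground set, so the family can be enlarged too and keeps pace with the larger set.\<close>
  have cover: "V - S \<subseteq> \<Union> \<K>"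
  proof
    fix v assume v: "v \<in> V - S"
    show "v \<in> \<Union> \<K>"
    proof (rule ccontr)
      assume nv: "v \<notin> \<Union> \<K>"
      have fam': "odd_family E (V - insert v S) \<K>"
        using fam nv unfolding odd_family_def by blast
      have c: "card (insert v S) = Suc (card S)" using v fS by simp
      have "card (V - insert v S) + card (insert v S) = card V"
        using v SV fV fS by (metis Diff_subset add.commute card_Diff_subset card_mono finite_insert insert_subset le_add_diff_inverse DiffD1)
      then have "odd (card (V - insert v S) + card \<K>)"
        using c card\<K> evenV by presburger
      from odd_family_augment[OF _ assms(2) fam' this] fV
      obtain \<L> where "odd_family E (V - insert v S) \<L>" "card \<L> = Suc (card \<K>)" by blast
      then show False using maxi[of "insert v S" \<L>] v SV c card\<K> by simp
    qed
  qed

  \<comment> \<open>A violation in \<open>K - {v}\<close> has excess at least two after a parity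
    correction, as \<open>card K\<close> is odd. Replacing \<open>K\<close> by that family loses one
    member and gains at least \<open>card U + 2\<close>, while \<open>S\<close> grows by
    \<open>card U + 1\<close>, contrary to \<open>maxi\<close>.\<close>
  have inner: "\<exists>m. \<forall>x\<in>K - {v}. m x \<in> K - {v} \<and> m (m x) = x \<and> E x (m x)"
    if K: "K \<in> \<K>" and v: "v \<in> K" for K v
  proof (rule less.hyps[OF _ _ assms(2)])
    have "K - {v} \<subset> V" using Ksub[OF K] v by blast
    then show "card (K - {v}) < card V" using fV psubset_card_mono by blast
    show "finite (K - {v})" using fK[OF K] by simp
    fix U \<L> assume U: "U \<subseteq> K - {v}" and \<L>: "odd_family E (K - {v} - U) \<L>"
    have fU: "finite U" using U fK[OF K] finite_subset by blast
    have cK: "card (K - {v} - U) + card U + 1 = card K"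
      using U fU fK[OF K] v by (metis Suc_eq_plus1 add.commute card_Diff_subset card_Suc_Diff1 card_mono finite_Diff le_add_diff_inverse)
    show "card \<L> \<le> card U"
    proof (rule ccontr)
      assume "\<not> card \<L> \<le> card U"
      then consider "card \<L> = card U + 1" | "card \<L> \<ge> card U + 2" by linarith
      then have "\<exists>\<M>. odd_family E (K - {v} - U) \<M> \<and> card \<M> \<ge> card U + 2"
      proof cases
        case 1
        then have "odd (card (K - {v} - U) + card \<L>)" using cK Kodd[OF K] by presburger
        from odd_family_augment[OF _ assms(2) \<L> this] fK[OF K] 1 show ?thesis by force
      qed (use \<L> in blast)
      then obtain \<M> where \<M>: "odd_family E (K - {v} - U) \<M>" "card \<M> \<ge> card U + 2" by blast
      define U' where "U' = S \<union> insert v U"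
      have U'V: "U' \<subseteq> V" using U v SV Ksub[OF K] unfolding U'_def by blast
      have "S \<inter> insert v U = {}" using U v Ksub[OF K] by blast
      then have "card U' = card S + card (insert v U)" unfolding U'_def
        using fS fU by (intro card_Un_disjoint) auto
      moreover have "card (insert v U) = card U + 1" using fU U by (subst card_insert_disjoint) auto
      ultimately have cU': "card U' = card S + card U + 1" by simp
      have Msub: "M \<subseteq> K - {v} - U" "M \<noteq> {}" "odd (card M)" if "M \<in> \<M>" for M
        using \<M>(1) that unfolding odd_family_def by auto
      have Lout: "L \<inter> K = {}" if "L \<in> \<K> - {K}" for L using disj K that by blast
      have d1: "(\<K> - {K}) \<inter> \<M> = {}"
      proof (rule ccontr)
        assume "(\<K> - {K}) \<inter> \<M> \<noteq> {}"
        then obtain L where "L \<in> \<K> - {K}" "L \<in> \<M>" by blast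
        then have "L \<inter> K = {}" "L \<subseteq> K" "L \<noteq> {}" using Lout Msub by blast+
        then show False by blast
      qed
      have "odd_family E (V - U') (\<K> - {K} \<union> \<M>)"
        unfolding odd_family_def
      proof (intro conjI ballI)
        show "pairwise disjnt (\<K> - {K} \<union> \<M>)"
        proof (rule pairwiseI)
          fix P Q assume "P \<in> \<K> - {K} \<union> \<M>" "Q \<in> \<K> - {K} \<union> \<M>" "P \<noteq> Q"
          moreover have "disjnt P Q" if "P \<in> \<M>" "Q \<in> \<M>" "P \<noteq> Q"
            using \<M>(1) that unfolding odd_family_def pairwise_def by blast
          moreover have "disjnt P Q" if "P \<in> \<K>" "Q \<in> \<K>" "P \<noteq> Q"
            using fam that unfolding odd_family_def pairwise_def by blast
          moreover have "disjnt P Q \<and> disjnt Q P" if "P \<in> \<K> - {K}" "Q \<in> \<M>" for P Q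
            using Lout[OF that(1)] Msub(1)[OF that(2)] unfolding disjnt_def by blast
          ultimately show "disjnt P Q" by blast
        qed
        fix L assume L: "L \<in> \<K> - {K} \<union> \<M>"
        show "L \<subseteq> V - U'"
        proof (cases "L \<in> \<M>")
          case True
          then show ?thesis using Msub(1)[OF True] Ksub[OF K] unfolding U'_def by blast
        next
          case False
          then have "L \<in> \<K> - {K}" using L by blast
          then show ?thesis using Lout[of L] Ksub[of L] U v unfolding U'_def by blast
        qed
        show "odd (card L)" using L Msub(3) Kodd by blast
        fix x y assume x: "x \<in> L" and y: "y \<in> V - U' - L"
        show "\<not> E x y"
        proof (cases "L \<in> \<M>")
          case True
          show ?thesis
          proof (cases "y \<in> K")
            case yK: True
            then have "y \<in> K - {v} - U - L" using y unfolding U'_def by blast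
            then show ?thesis using \<M>(1) True x unfolding odd_family_def by blast
          next
            case False
            then show ?thesis using Kclosed[OF K] x y Msub(1)[OF True] unfolding U'_def by blast
          qed
        next
          case False
          then show ?thesis using Kclosed[of L x y] L x y unfolding U'_def by blast
        qed
      qed
      moreover have "card (\<K> - {K} \<union> \<M>) = card (\<K> - {K}) + card \<M>"
        using d1 f\<K> finite_odd_family[OF _ \<M>(1)] fK[OF K] by (intro card_Un_disjoint) auto
      moreover have "card (\<K> - {K}) + 1 = card \<K>"
        using K f\<K> by (metis Suc_eq_plus1 card_Suc_Diff1)
      ultimately show False
        using maxi[of U' "\<K> - {K} \<union> \<M>"] U'V cU' card\<K> \<M>(2) by linarith
    qed
  qed

  define N where "N K = {s \<in> S. \<exists>x\<in>K. E x s}" for K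
  \<comment> \<open>Deleting just the neighbours of \<open>\<Y>\<close> in \<open>S\<close> keeps
    the members of \<open>\<Y>\<close> closed, so Tutte's condition for that set is Hall's
    condition.\<close>
  have "\<exists>f. inj_on f \<K> \<and> (\<forall>K\<in>\<K>. f K \<in> N K)"
  proof (rule hall_marriage[OF f\<K>])
    show "finite (N K)" for K using fS unfolding N_def by simp
    fix \<Y> assume Y: "\<Y> \<subseteq> \<K>"
    have "\<Union> (N ` \<Y>) \<subseteq> V" using SV unfolding N_def by blast
    moreover have "odd_family E (V - \<Union> (N ` \<Y>)) \<Y>"
      unfolding odd_family_def
    proof (intro conjI ballI)
      show "pairwise disjnt \<Y>" using fam Y pairwise_subset unfolding odd_family_def by blast
      fix K assume K: "K \<in> \<Y>"
      then have K': "K \<in> \<K>" using Y by blast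
      show "K \<subseteq> V - \<Union> (N ` \<Y>)" using Ksub[OF K'] unfolding N_def by blast
      show "odd (card K)" using Kodd[OF K'] .
      fix x y assume "x \<in> K" "y \<in> V - \<Union> (N ` \<Y>) - K"
      then show "\<not> E x y" using Kclosed[OF K', of x y] K unfolding N_def by blast
    qed
    ultimately show "card \<Y> \<le> card (\<Union> (N ` \<Y>))" using tutte by blast
  qed
  then obtain f where finj: "inj_on f \<K>" and fN: "\<And>K. K \<in> \<K> \<Longrightarrow> f K \<in> N K" by blast
  have "f ` \<K> \<subseteq> S" using fN unfolding N_def by blast
  \<comment> \<open>Equal cardinalities make \<open>f\<close> onto \<open>S\<close>, so no vertex of
    \<open>S\<close> stays unmatched.\<close>
  then have fim: "f ` \<K> = S" using card_image[OF finj] card\<K> fS card_subset_eq by metis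
  have "\<forall>K\<in>\<K>. \<exists>x\<in>K. E x (f K)" using fN unfolding N_def by blast
  then obtain g where g: "\<And>K. K \<in> \<K> \<Longrightarrow> g K \<in> K" "\<And>K. K \<in> \<K> \<Longrightarrow> E (g K) (f K)" by metis
  have "\<forall>K\<in>\<K>. \<exists>m. \<forall>x\<in>K - {g K}. m x \<in> K - {g K} \<and> m (m x) = x \<and> E x (m x)"
    using inner g(1) by blast
  then obtain mm where mm: "\<And>K x. K \<in> \<K> \<Longrightarrow> x \<in> K - {g K} \<Longrightarrow>
      mm K x \<in> K - {g K} \<and> mm K (mm K x) = x \<and> E x (mm K x)"
    by metis
  define part where "part x = (THE K. K \<in> \<K> \<and> x \<in> K)" for x
  have part: "part x = K" if "x \<in> K" "K \<in> \<K>" for x K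
    unfolding part_def using that disj by (intro the_equality) auto
  \<comment> \<open>Each \<open>f K\<close> is paired with its neighbour \<open>g K\<close>, and the
    rest of \<open>K\<close> by its inner matching \<open>mm K\<close>.\<close>
  define m where "m x = (if x \<in> S then g (inv_into \<K> f x)
      else if x = g (part x) then f (part x) else mm (part x) x)" for x
  have fS': "f K \<in> S" if "K \<in> \<K>" for K using fim that by blast
  have m_f: "m (f K) = g K" if "K \<in> \<K>" for K
    using that fS' finj by (simp add: m_def)
  have notS: "x \<notin> S" if "x \<in> K" "K \<in> \<K>" for x K using Ksub that by blast
  have m_g: "m (g K) = f K" if "K \<in> \<K>" for K
    using that g(1)[OF that] notS part by (simp add: m_def)
  have m_in: "m x = mm K x" if "x \<in> K - {g K}" "K \<in> \<K>" for x K
    using that notS part[of x K] by (auto simp: m_def)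
  have "m v \<in> V \<and> m (m v) = v \<and> E v (m v)" if v: "v \<in> V" for v
  proof (cases "v \<in> S")
    case True
    then obtain K where K: "K \<in> \<K>" "v = f K" using fim by blast
    then show ?thesis using m_f m_g g Ksub sympD[OF assms(2)] by (metis DiffD1 subsetD)
  next
    case False
    then obtain K where K: "K \<in> \<K>" "v \<in> K" using v cover by blast
    show ?thesis
    proof (cases "v = g K")
      case True
      then show ?thesis using K(1) m_f m_g g(2) fS' SV by auto
    next
      case False
      then have vK: "v \<in> K - {g K}" using K by blast
      note * = mm[OF K(1) vK]
      have "m (m v) = mm K (mm K v)" using m_in[OF _ K(1)] vK * by metis
      then show ?thesis using * m_in[OF vK K(1)] Ksub[OF K(1)] by auto
    qed
  qed
  then show ?case by blast
qed

text \<open>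
  In a smallest barrier every vertex sees three odd sets: otherwise it could be dropped together with
  the at most two it sees.
\<close>

lemma tutte_minimal_barrier:
  assumes "finite V" and "symp E" and "even (card V)"
    and no_matching: "\<not> (\<exists>m. \<forall>v\<in>V. m v \<in> V \<and> m (m v) = v \<and> E v (m v))"
  shows "\<exists>U \<K>. U \<subseteq> V \<and> odd_family E (V - U) \<K> \<and> card \<K> \<ge> card U + 2 \<and>
    (\<forall>u\<in>U. card {K \<in> \<K>. \<exists>y\<in>K. E u y} \<ge> 3)"
proof -
  define bad where "bad U \<longleftrightarrow> U \<subseteq> V \<and> (\<exists>\<K>. odd_family E (V - U) \<K> \<and> card U < card \<K>)" for U
  have "\<exists>U. bad U"
  proof (rule ccontr)
    assume "\<nexists>U. bad U"
    then have "card \<K> \<le> card U" if "U \<subseteq> V" "odd_family E (V - U) \<K>" for U \<K>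
      using that unfolding bad_def by (meson not_le)
    then show False using tutte_perfect_matching[OF assms(1,2)] no_matching by blast
  qed
  then obtain U where bad: "bad U" and least: "\<And>U'. bad U' \<Longrightarrow> card U \<le> card U'"
    using ex_has_least_nat[of bad _ card] by metis
  obtain \<K>0 where UV: "U \<subseteq> V" and \<K>0: "odd_family E (V - U) \<K>0" "card U < card \<K>0"
    using bad unfolding bad_def by blast
  have fU: "finite U" using UV assms(1) finite_subset by blast
  have fW: "finite (V - U)" using assms(1) by simp
  have "card (V - U) + card U = card V"
    using UV fU assms(1) by (metis add.commute card_Diff_subset card_mono le_add_diff_inverse)
  then have parity: "even (card (V - U)) \<longleftrightarrow> even (card U)" using assms(3) by (metis even_add)
  \<comment> \<open>The sizes of \<open>V - U\<close> and \<open>U\<close> have the same parity, so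
    an excess of one leaves an odd remainder, which becomes another member.\<close>
  have "\<exists>\<K>. odd_family E (V - U) \<K> \<and> card \<K> \<ge> card U + 2"
  proof (cases "card \<K>0 = card U + 1")
    case True
    then have "odd (card (V - U) + card \<K>0)" using parity by simp
    from odd_family_augment[OF fW assms(2) \<K>0(1) this] True show ?thesis by auto
  next
    case False
    then show ?thesis using \<K>0 by (intro exI[of _ \<K>0]) simp
  qed
  then obtain \<K> where fam: "odd_family E (V - U) \<K>" and card\<K>: "card \<K> \<ge> card U + 2" by blast
  have "card {K \<in> \<K>. \<exists>y\<in>K. E u y} \<ge> 3" if u: "u \<in> U" for u
  proof (rule ccontr)
    define M where "M = {K \<in> \<K>. \<exists>y\<in>K. E u y}"
    assume "\<not> card {K \<in> \<K>. \<exists>y\<in>K. E u y} \<ge> 3"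
    then have cM: "card M \<le> 2" unfolding M_def by simp
    have f\<K>: "finite \<K>" using finite_odd_family[OF fW fam] .
    have "odd_family E (V - (U - {u})) (\<K> - M)"
      unfolding odd_family_def
    proof (intro conjI ballI)
      show "pairwise disjnt (\<K> - M)"
        using fam unfolding odd_family_def by (blast intro: pairwise_subset)
      fix K assume K: "K \<in> \<K> - M"
      show "K \<subseteq> V - (U - {u})" "odd (card K)" using K fam unfolding odd_family_def by blast+
      fix x y assume x: "x \<in> K" and y: "y \<in> V - (U - {u}) - K"
      show "\<not> E x y"
      proof (cases "y = u")
        case True
        then show ?thesis using K x sympD[OF assms(2), of x u] unfolding M_def by blast
      next
        case False
        then show ?thesis using K x y fam unfolding odd_family_def by blast
      qed
    qed
    moreover have "card (\<K> - M) \<ge> card \<K> - card M"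
      using f\<K> by (intro diff_card_le_card_Diff finite_subset[of M \<K>]) (auto simp: M_def)
    moreover have "card (U - {u}) < card U" using fU u by (meson card_Diff1_less)
    moreover have "card U \<le> card (\<K> - M)" using calculation(2) card\<K> cM by linarith
    moreover have "U - {u} \<subseteq> V" using UV by blast
    ultimately have "bad (U - {u})" unfolding bad_def using order.strict_trans2 by blast
    then show False using least \<open>card (U - {u}) < card U\<close> by (meson not_le)
  qed
  then show ?thesis using UV fam card\<K> by blast
qed

section \<open>Degree-constrained subgraphs of multigraphs\<close>

lemma even_card_involution:
  assumes "finite X" and "\<And>x. x \<in> X \<Longrightarrow> p x \<in> X \<and> p (p x) = x \<and> p x \<noteq> x"
  shows "even (card X)"
  using assms
proof (induction "card X" arbitrary: X rule: less_induct)
  case less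
  show ?case
  proof (cases "X = {}")
    case False
    then obtain x where x: "x \<in> X" by blast
    have px: "p x \<in> X" "p (p x) = x" "p x \<noteq> x" using less.prems(2)[OF x] by auto
    have "card (X - {x, p x}) < card X"
      using less.prems(1) x by (intro psubset_card_mono) auto
    moreover have "p y \<in> X - {x, p x} \<and> p (p y) = y \<and> p y \<noteq> y" if "y \<in> X - {x, p x}" for y
    proof -
      have "p (p y) = y" "p y \<in> X" "p y \<noteq> y" using less.prems(2)[of y] that by auto
      moreover have "p y \<noteq> x" "p y \<noteq> p x" using calculation(1) px(2) that by auto
      ultimately show ?thesis by blast
    qed
    ultimately have "even (card (X - {x, p x}))" using less.hyps less.prems(1) by blast
    moreover have "card X = card (X - {x, p x}) + 2"
      using px x less.prems(1) card_Diff_subset[of "{x, p x}" X] card_mono[of X "{x, p x}"] by simp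
    ultimately show ?thesis by simp
  qed simp
qed

lemma card_disjoint_family_meeting_le:
  assumes "finite Z" and "pairwise disjnt \<K>" and "\<And>K. K \<in> \<K> \<Longrightarrow> K \<inter> Z \<noteq> {}"
  shows "card \<K> \<le> card Z"
proof -
  have "\<forall>K\<in>\<K>. \<exists>x. x \<in> K \<inter> Z" using assms(3) by blast
  then obtain g where g: "\<And>K. K \<in> \<K> \<Longrightarrow> g K \<in> K \<inter> Z" by metis
  have "inj_on g \<K>"
  proof (rule inj_onI, rule ccontr)
    fix K L assume KL: "K \<in> \<K>" "L \<in> \<K>" "g K = g L" "K \<noteq> L"
    then have "disjnt K L" using assms(2) unfolding pairwise_def by blast
    then show False using g[OF KL(1)] g[OF KL(2)] KL(3) unfolding disjnt_def by auto
  qed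
  then show ?thesis using g assms(1) by (intro card_inj_on_le[of g]) auto
qed

text \<open>
  A finite multigraph, loops allowed, given by its half-edges: \<open>p\<close> sends a half-edge to the other
  half of its edge and \<open>own\<close> to the vertex it is attached to.
\<close>

locale dart_graph =
  fixes V :: "'v set" and A :: "'d set" and p :: "'d \<Rightarrow> 'd" and own :: "'d \<Rightarrow> 'v"
    and f :: "'v \<Rightarrow> nat"
  assumes finite_V: "finite V" and finite_A: "finite A"
    and own_in: "x \<in> A \<Longrightarrow> own x \<in> V"
    and p_in: "x \<in> A \<Longrightarrow> p x \<in> A"
    and p_p: "x \<in> A \<Longrightarrow> p (p x) = x"
    and p_neq: "x \<in> A \<Longrightarrow> p x \<noteq> x"
    and f_le_deg: "v \<in> V \<Longrightarrow> f v \<le> card {x \<in> A. own x = v}"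
begin

abbreviation deg :: "'v \<Rightarrow> nat" where
  "deg v \<equiv> card {x \<in> A. own x = v}"

section \<open>Tutte's gadget and the sizes of its pieces\<close>

definition darts :: "'v \<Rightarrow> ('d + 'v \<times> nat) set" where
  "darts v = Inl ` {x \<in> A. own x = v}"

definition slots :: "'v \<Rightarrow> ('d + 'v \<times> nat) set" where
  "slots v = Inr ` ({v} \<times> {..<deg v - f v})"

definition gadget :: "('d + 'v \<times> nat) set" where
  "gadget = (\<Union>v\<in>V. darts v \<union> slots v)"

text \<open>In Tutte's gadget a vertex is replaced by a complete bipartite graph between its
  half-edges and its slots, and each edge survives between its two halves.\<close>

definition adj :: "'d + 'v \<times> nat \<Rightarrow> 'd + 'v \<times> nat \<Rightarrow> bool" where
  "adj a b \<longleftrightarrow> (\<exists>x\<in>A. a = Inl x \<and> b = Inl (p x)) \<or>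
    (\<exists>v\<in>V. a \<in> darts v \<and> b \<in> slots v \<or> a \<in> slots v \<and> b \<in> darts v)"

lemma symp_adj: "symp adj"
  unfolding adj_def by (rule sympI) (metis p_in p_p)

lemma adj_p: "x \<in> A \<Longrightarrow> adj (Inl x) (Inl (p x))"
  unfolding adj_def by blast

lemma adj_dart_slot: "v \<in> V \<Longrightarrow> a \<in> darts v \<Longrightarrow> b \<in> slots v \<Longrightarrow> adj a b \<and> adj b a"
  unfolding adj_def by blast

lemma finite_darts: "finite (darts v)" and finite_slots: "finite (slots v)"
  using finite_A by (auto simp: darts_def slots_def)

lemma card_darts: "card (darts v) = deg v"
  unfolding darts_def by (rule card_image) simp

lemma card_slots: "card (slots v) = deg v - f v"
  unfolding slots_def by (subst card_image) simp_all

lemma finite_gadget: "finite gadget"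
  unfolding gadget_def using finite_V finite_darts finite_slots by blast

lemma darts_eqD: "a \<in> darts v \<Longrightarrow> a \<in> darts w \<Longrightarrow> v = w"
  and slots_eqD: "a \<in> slots v \<Longrightarrow> a \<in> slots w \<Longrightarrow> v = w"
  and darts_slots: "darts v \<inter> slots w = {}"
  by (auto simp: darts_def slots_def)

lemma Inl_in_darts: "Inl x \<in> darts v \<longleftrightarrow> x \<in> A \<and> own x = v"
  by (auto simp: darts_def)

lemma Inl_in_gadget: "x \<in> A \<Longrightarrow> Inl x \<in> gadget"
  unfolding gadget_def using own_in Inl_in_darts by blast

lemma gadget_cases:
  assumes "a \<in> gadget"
  obtains x where "x \<in> A" "a = Inl x" "a \<in> darts (own x)" | v where "v \<in> V" "a \<in> slots v"
  using assms unfolding gadget_def darts_def by blast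

lemma card_UN_darts_slots:
  assumes "W \<subseteq> V"
  shows "card (\<Union>v\<in>W. darts v \<union> slots v) = (\<Sum>v\<in>W. deg v + (deg v - f v))"
proof -
  have "finite W" using assms finite_V finite_subset by blast
  moreover have "card (darts v \<union> slots v) = deg v + (deg v - f v)" for v
    using finite_darts finite_slots darts_slots card_darts card_slots by (metis card_Un_disjoint)
  moreover have "(darts v \<union> slots v) \<inter> (darts w \<union> slots w) = {}" if "v \<noteq> w" for v w
    using that darts_eqD slots_eqD darts_slots by blast
  ultimately show ?thesis
    using finite_darts finite_slots by (subst card_UN_disjoint) auto
qed

lemma card_UN_slots:
  assumes "W \<subseteq> V"
  shows "card (\<Union>v\<in>W. slots v) = (\<Sum>v\<in>W. deg v - f v)"
proof -
  have "finite W" using assms finite_V finite_subset by blast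
  moreover have "slots v \<inter> slots w = {}" if "v \<noteq> w" for v w
    using that slots_eqD by blast
  ultimately show ?thesis
    using finite_slots card_slots by (subst card_UN_disjoint) auto
qed

lemma card_UN_darts:
  assumes "W \<subseteq> V"
  shows "card (\<Union>v\<in>W. darts v) = (\<Sum>v\<in>W. deg v)"
proof -
  have "finite W" using assms finite_V finite_subset by blast
  moreover have "darts v \<inter> darts w = {}" if "v \<noteq> w" for v w
    using that darts_eqD by blast
  ultimately show ?thesis
    using finite_darts card_darts by (subst card_UN_disjoint) auto
qed

text \<open>The truncated subtraction is exact by \<open>f_le_deg\<close>.\<close>

lemma sum_deg_Diff: "(\<Sum>v\<in>W. deg v - f v) + (\<Sum>v\<in>W. f v) = (\<Sum>v\<in>W. deg v)" if "W \<subseteq> V"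
  using that f_le_deg unfolding sum.distrib[symmetric] by (intro sum.cong) auto

text \<open>Each vertex contributes \<open>2 * deg v - f v\<close> elements, which has the parity of
  \<open>f v\<close>.\<close>

lemma even_gadget_iff:
  assumes "W \<subseteq> V"
  shows "even (card (\<Union>v\<in>W. darts v \<union> slots v)) \<longleftrightarrow> even (\<Sum>v\<in>W. f v)"
proof -
  have *: "card (\<Union>v\<in>W. darts v \<union> slots v) + (\<Sum>v\<in>W. f v) = 2 * (\<Sum>v\<in>W. deg v)"
    unfolding card_UN_darts_slots[OF assms] sum.distrib using sum_deg_Diff[OF assms] by simp
  have "even (card (\<Union>v\<in>W. darts v \<union> slots v) + (\<Sum>v\<in>W. f v))" unfolding * by simp
  then show ?thesis unfolding even_add .
qed

text \<open>
  In a perfect matching of the gadget the slots of \<open>v\<close> absorb all but \<open>f v\<close> of its half-edges; the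
  remaining ones are matched along edges.
\<close>

lemma factor_of_perfect_matching:
  assumes m: "\<forall>a\<in>gadget. m a \<in> gadget \<and> m (m a) = a \<and> adj a (m a)"
  shows "\<exists>F\<subseteq>A. p ` F \<subseteq> F \<and> (\<forall>v\<in>V. card {x \<in> F. own x = v} = f v)"
proof (intro exI conjI ballI)
  define F where "F = {x \<in> A. m (Inl x) = Inl (p x)}"
  show "F \<subseteq> A" unfolding F_def by blast
  show "p ` F \<subseteq> F"
  proof
    fix y assume "y \<in> p ` F"
    then obtain x where x: "x \<in> A" "m (Inl x) = Inl (p x)" "y = p x" unfolding F_def by blast
    then have "m (Inl y) = Inl x" using m Inl_in_gadget by metis
    then show "y \<in> F" unfolding F_def using x p_in p_p by simp
  qed
  fix v assume v: "v \<in> V"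
  define X where "X = {x \<in> A. own x = v} - F"
  have "bij_betw m (slots v) (Inl ` X)"
  proof (rule bij_betwI[where g = m])
    have slotsG: "slots v \<subseteq> gadget" using v unfolding gadget_def by blast
    show "m \<in> slots v \<rightarrow> Inl ` X"
    proof
      fix a assume a: "a \<in> slots v"
      have ma: "m a \<in> gadget" "m (m a) = a" "adj a (m a)" using m a slotsG by blast+
      have "m a \<in> darts v" using ma(3) a slots_eqD darts_slots unfolding adj_def slots_def by blast
      then obtain x where x: "m a = Inl x" "x \<in> A" "own x = v" unfolding darts_def by blast
      have "x \<notin> F" using ma(2) a x(1) unfolding F_def slots_def by auto
      then show "m a \<in> Inl ` X" using x unfolding X_def by blast
    qed
    show "m \<in> Inl ` X \<rightarrow> slots v"
    proof
      fix a :: "'d + 'v \<times> nat" assume "a \<in> Inl ` X"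
      then obtain x where x: "a = Inl x" "x \<in> A" "own x = v" "x \<notin> F" unfolding X_def by blast
      have "adj (Inl x) (m (Inl x))" using m Inl_in_gadget x by blast
      moreover have "m (Inl x) \<noteq> Inl (p x)" using x unfolding F_def by blast
      ultimately obtain w where "Inl x \<in> darts w" "m (Inl x) \<in> slots w"
        unfolding adj_def slots_def by blast
      then show "m a \<in> slots v" using x Inl_in_darts by metis
    qed
    show "m (m a) = a" if "a \<in> slots v" for a using m that slotsG by blast
    show "m (m a) = a" if "a \<in> Inl ` X" for a
      using m that Inl_in_gadget unfolding X_def by blast
  qed
  then have "card (slots v) = card X"
    by (metis bij_betw_same_card card_image inj_Inl)
  then have "card X = deg v - f v" using card_slots by simp
  moreover have "{x \<in> F. own x = v} = {x \<in> A. own x = v} - X"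
    unfolding X_def F_def by blast
  moreover have "X \<subseteq> {x \<in> A. own x = v}" "finite {x \<in> A. own x = v}" 
    unfolding X_def using finite_A by auto
  ultimately show "card {x \<in> F. own x = v} = f v"
    using f_le_deg[OF v] by (simp add: card_Diff_subset finite_subset)
qed


text \<open>
  A smallest barrier \<open>U\<close> of the gadget contains all or none of the half-edges at \<open>v\<close>, and all or none of
  its slots. The vertices whose half-edges lie in \<open>U\<close> form \<open>S\<close>, those whose slots lie in \<open>U\<close> form \<open>T\<close>.
  Odd sets of the gadget that meet a slot of \<open>S\<close> or a half-edge from \<open>T\<close> to \<open>S\<close> are few; each of the
  others consists of whole vertex gadgets outside \<open>S \<union> T\<close> plus half-edges at \<open>T\<close>.
\<close>

theorem f_factor_barrier:
  assumes even_f: "even (\<Sum>v\<in>V. f v)"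
    and no_factor: "\<not> (\<exists>F\<subseteq>A. p ` F \<subseteq> F \<and> (\<forall>v\<in>V. card {x \<in> F. own x = v} = f v))"
  shows "\<exists>S T \<C>. S \<subseteq> V \<and> T \<subseteq> V \<and> S \<inter> T = {} \<and> pairwise disjnt \<C> \<and>
    (\<forall>C\<in>\<C>. C \<subseteq> V - S - T \<and> (\<forall>x\<in>A. own x \<in> C \<longrightarrow> own (p x) \<in> C \<union> S \<union> T) \<and>
      odd ((\<Sum>v\<in>C. f v) + card {x \<in> A. own x \<in> C \<and> own (p x) \<in> T})) \<and>
    (\<Sum>v\<in>S. f v) + card {x \<in> A. own x \<in> T \<and> own (p x) \<notin> S} + 2 \<le> card \<C> + (\<Sum>v\<in>T. f v)"
proof -
  have "even (card gadget)" using even_f even_gadget_iff[of V] unfolding gadget_def by blast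
  moreover have "\<not> (\<exists>m. \<forall>a\<in>gadget. m a \<in> gadget \<and> m (m a) = a \<and> adj a (m a))"
    using factor_of_perfect_matching no_factor by blast
  ultimately obtain U \<K> where UG: "U \<subseteq> gadget" and fam: "odd_family adj (gadget - U) \<K>"
    and card\<K>: "card U + 2 \<le> card \<K>"
    and touch: "\<And>u. u \<in> U \<Longrightarrow> 3 \<le> card {K \<in> \<K>. \<exists>b\<in>K. adj u b}"
    using tutte_minimal_barrier[OF finite_gadget symp_adj] by blast
  have f\<K>: "finite \<K>" using finite_odd_family[OF _ fam] finite_gadget by simp
  have disj: "K = L" if "a \<in> K" "a \<in> L" "K \<in> \<K>" "L \<in> \<K>" for a K L
    using fam that unfolding odd_family_def pairwise_def disjnt_def by blast
  have Ksub: "K \<subseteq> gadget - U" and Kodd: "odd (card K)"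
    and Kclosed: "\<And>a b. a \<in> K \<Longrightarrow> adj a b \<Longrightarrow> b \<in> gadget - U \<Longrightarrow> b \<in> K"
    if "K \<in> \<K>" for K
    using fam that unfolding odd_family_def by blast+
  have fK: "finite K" if "K \<in> \<K>" for K using Ksub[OF that] finite_gadget finite_subset by blast
  have in_gadget: "darts v \<subseteq> gadget" "slots v \<subseteq> gadget" if "v \<in> V" for v
    using that unfolding gadget_def by blast+

  have few: "card {K \<in> \<K>. c \<in> K \<or> d \<in> K} \<le> 2" for c d
  proof -
    have one: "card {K \<in> \<K>. c \<in> K} \<le> 1" for c
    proof -
      \<comment> \<open>Members containing \<open>c\<close> coincide; if there are none,
        \<open>THE\<close> is arbitrary but the left side is empty.\<close>
      have "{K \<in> \<K>. c \<in> K} \<subseteq> {THE K. K \<in> \<K> \<and> c \<in> K}"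
        using disj by (auto intro!: the_equality[symmetric])
      then show ?thesis using card_mono[of "{THE K. K \<in> \<K> \<and> c \<in> K}"] by simp
    qed
    have "{K \<in> \<K>. c \<in> K \<or> d \<in> K} = {K \<in> \<K>. c \<in> K} \<union> {K \<in> \<K>. d \<in> K}" by blast
    then show ?thesis
      using card_Un_le[of "{K \<in> \<K>. c \<in> K}" "{K \<in> \<K>. d \<in> K}"] one[of c] one[of d] by simp
  qed
  \<comment> \<open>Used for every all-or-none claim: if each member seen by \<open>u\<close>
    contains one of two fixed elements, \<open>u\<close> sees at most two members, against
    \<open>touch\<close>.\<close>
  have touch_two: False
    if "u \<in> U" "\<And>K b. K \<in> \<K> \<Longrightarrow> b \<in> K \<Longrightarrow> adj u b \<Longrightarrow> c \<in> K \<or> d \<in> K" for u c d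
  proof -
    have "card {K \<in> \<K>. \<exists>b\<in>K. adj u b} \<le> card {K \<in> \<K>. c \<in> K \<or> d \<in> K}"
      using f\<K> that(2) by (intro card_mono) auto
    then show False using touch[OF that(1)] few[of c d] by linarith
  qed

  \<comment> \<open>For \<open>u\<close> in \<open>U\<close> at \<open>v\<close> and
    \<open>c\<close> at \<open>v\<close> outside \<open>U\<close>, a member seen by \<open>u\<close>
    contains the other half of \<open>u\<close>, or a slot of \<open>v\<close> and with it
    \<open>c\<close>.\<close>
  have darts_all: "darts v \<subseteq> U" if v: "v \<in> V" and meets: "darts v \<inter> U \<noteq> {}" for v
  proof (rule ccontr)
    assume "\<not> darts v \<subseteq> U"
    then obtain c where c: "c \<in> darts v" "c \<notin> U" by blast
    obtain u where u: "u \<in> darts v" "u \<in> U" using meets by blast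
    obtain x where x: "x \<in> A" "u = Inl x" "own x = v" using u(1) unfolding darts_def by blast
    show False
    proof (rule touch_two[OF u(2), of c "Inl (p x)"])
      fix K b assume K: "K \<in> \<K>" "b \<in> K" "adj u b"
      from K(3) consider "b = Inl (p x)" | "b \<in> slots v"
        using u(1) x(2) darts_eqD darts_slots unfolding adj_def by blast
      then show "c \<in> K \<or> Inl (p x) \<in> K"
      proof cases
        case 2
        then have "adj b c" using adj_dart_slot[OF v c(1)] by blast
        then show ?thesis using Kclosed[OF K(1,2)] c in_gadget[OF v] by blast
      qed (use K(2) in blast)
    qed
  qed
  \<comment> \<open>If the half-edges at \<open>v\<close> lay in \<open>U\<close>, a slot in
    \<open>U\<close> would see no member; otherwise a slot \<open>c\<close> outside \<open>U\<close>
    would lie in every member seen by a slot in \<open>U\<close>.\<close>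
  have slots_all: "slots v \<subseteq> U \<and> darts v \<inter> U = {}" if v: "v \<in> V" and meets: "slots v \<inter> U \<noteq> {}" for v
  proof -
    obtain u where u: "u \<in> slots v" "u \<in> U" using meets by blast
    have nbr: "b \<in> darts v" if "adj u b" for b
      using that u(1) slots_eqD darts_slots unfolding adj_def slots_def by blast
    have *: "darts v \<inter> U = {}"
    proof (rule ccontr)
      assume "darts v \<inter> U \<noteq> {}"
      then have "darts v \<subseteq> U" using darts_all v by blast
      then show False using touch_two[OF u(2)] nbr Ksub by blast
    qed
    moreover have "slots v \<subseteq> U"
    proof (rule ccontr)
      assume "\<not> slots v \<subseteq> U"
      then obtain c where c: "c \<in> slots v" "c \<notin> U" by blast
      have "c \<in> K" if K: "K \<in> \<K>" "b \<in> K" "adj u b" for K b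
        using Kclosed[OF K(1,2)] adj_dart_slot[OF v nbr[OF K(3)] c(1)] c in_gadget[OF v] by blast
      then show False using touch_two[OF u(2), of c c] by blast
    qed
    ultimately show ?thesis by blast
  qed

  \<comment> \<open>Requiring \<open>darts v \<noteq> {}\<close> keeps \<open>S\<close> and
    \<open>T\<close> disjoint: a vertex without half-edges has no slots either and falls into
    \<open>T\<close>.\<close>
  define S where "S = {v \<in> V. darts v \<noteq> {} \<and> darts v \<subseteq> U}"
  define T where "T = {v \<in> V. darts v \<inter> U = {} \<and> slots v \<subseteq> U}"
  have SV: "S \<subseteq> V" and TV: "T \<subseteq> V" and ST: "S \<inter> T = {}" unfolding S_def T_def by blast+
  have fS: "finite S" and fT: "finite T" using SV TV finite_V finite_subset by blast+
  have rest: "darts v \<inter> U = {}" "slots v \<inter> U = {}" "slots v \<noteq> {}" "darts v \<noteq> {}"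
    if v: "v \<in> V - S - T" for v
  proof -
    show d: "darts v \<inter> U = {}" using darts_all[of v] v unfolding S_def by blast
    then show "slots v \<inter> U = {}" using slots_all[of v] v unfolding T_def by blast
    show sl: "slots v \<noteq> {}" using d v unfolding T_def by blast
    show "darts v \<noteq> {}"
    proof
      assume "darts v = {}"
      then have "deg v = 0" using card_darts[of v] by simp
      then show False using sl unfolding slots_def by simp
    qed
  qed

  define A_TS where "A_TS = {x \<in> A. own x \<in> T \<and> own (p x) \<in> S}"
  define Z where "Z = (\<Union>v\<in>S. slots v) \<union> Inl ` A_TS"
  define \<K>1 where "\<K>1 = {K \<in> \<K>. K \<inter> Z = {}}"
  define base where "base K = {v \<in> V - S - T. darts v \<inter> K \<noteq> {}}" for K
  have \<K>1: "K \<in> \<K>" "K \<inter> Z = {}" if "K \<in> \<K>1" for K using that unfolding \<K>1_def by blast+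

  have own_not_S: "own x \<notin> S" if "x \<in> A" "Inl x \<notin> U" for x
    using that unfolding S_def darts_def by blast
  have dart_free: "Inl x \<in> gadget - U" if "x \<in> A" "own x \<notin> S" for x
    using that own_in rest(1)[of "own x"] Inl_in_darts[of x "own x"] Inl_in_gadget unfolding T_def by blast
  have whole: "darts v \<union> slots v \<subseteq> K"
    if K: "K \<in> \<K>" and v: "v \<in> V - S - T" and a: "a \<in> darts v \<union> slots v" "a \<in> K" for K v a
  proof -
    have vV: "v \<in> V" using v by blast
    have free: "darts v \<union> slots v \<subseteq> gadget - U" using rest[OF v] in_gadget[OF vV] by blast
    have ds: "slots v \<subseteq> K" if "c \<in> darts v" "c \<in> K" for c
      using Kclosed[OF K that(2)] adj_dart_slot[OF vV that(1)] free by blast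
    have sd: "darts v \<subseteq> K" if "c \<in> slots v" "c \<in> K" for c
      using Kclosed[OF K that(2)] adj_dart_slot[OF vV _ that(1)] free by blast
    show ?thesis using ds sd a rest(3,4)[OF v] by blast
  qed
  have base_sub: "(\<Union>v\<in>base K. darts v \<union> slots v) \<subseteq> K" if "K \<in> \<K>" for K
    using whole[OF that] unfolding base_def by blast
  have dart_in_base: "own x \<in> base K" if "K \<in> \<K>" "x \<in> A" "Inl x \<in> K" "own x \<notin> T" for K x
    using that Ksub own_in own_not_S Inl_in_darts[of x "own x"] unfolding base_def by blast
  have partner: "Inl (p x) \<in> K" if "K \<in> \<K>" "x \<in> A" "Inl x \<in> K" "own (p x) \<notin> S" for K x
    using Kclosed[OF that(1,3) adj_p[OF that(2)]] dart_free[OF p_in[OF that(2)] that(4)] by blast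
  have base_dart: "Inl x \<in> K" if "K \<in> \<K>" "x \<in> A" "own x \<in> base K" for K x
    using base_sub[OF that(1)] that(2,3) Inl_in_darts by blast

  \<comment> \<open>Besides whole gadgets, \<open>K\<close> has only half-edges at \<open>T\<close>.
    Those whose edge stays inside \<open>T\<close> (\<open>Y1\<close>) are paired off by
    \<open>p\<close>; the others (\<open>Y2\<close>) correspond under \<open>p\<close> to half-edges
    from \<open>base K\<close> to \<open>T\<close>, since \<open>K\<close> avoids
    \<open>Z\<close>.\<close>
  have odd_base: "odd ((\<Sum>v\<in>base K. f v) + card {x \<in> A. own x \<in> base K \<and> own (p x) \<in> T})"
    if K1: "K \<in> \<K>1" for K
  proof -
    note K = \<K>1(1)[OF K1]
    have no_TS: False if "x \<in> A" "Inl x \<in> K" "own x \<in> T" "own (p x) \<in> S" for x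
      using \<K>1(2)[OF K1] that unfolding Z_def A_TS_def by blast
    define Y1 where "Y1 = {x \<in> A. Inl x \<in> K \<and> own x \<in> T \<and> own (p x) \<in> T}"
    define Y2 where "Y2 = {x \<in> A. Inl x \<in> K \<and> own x \<in> T \<and> own (p x) \<notin> T}"
    define B where "B = {x \<in> A. own x \<in> base K \<and> own (p x) \<in> T}"
    have K_eq: "K = (\<Union>v\<in>base K. darts v \<union> slots v) \<union> Inl ` (Y1 \<union> Y2)"
    proof
      show "K \<subseteq> (\<Union>v\<in>base K. darts v \<union> slots v) \<union> Inl ` (Y1 \<union> Y2)"
      proof
        fix a assume a: "a \<in> K"
        then have aG: "a \<in> gadget" "a \<notin> U" using Ksub[OF K] by blast+
        from aG(1) show "a \<in> (\<Union>v\<in>base K. darts v \<union> slots v) \<union> Inl ` (Y1 \<union> Y2)"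
        proof (cases rule: gadget_cases)
          case (1 x)
          then show ?thesis
            using a dart_in_base[OF K, of x] unfolding Y1_def Y2_def by blast
        next
          case (2 v)
          have "v \<notin> S" using \<K>1(2)[OF K1] a 2 unfolding Z_def by blast
          moreover have "v \<notin> T" using aG(2) 2 unfolding T_def by blast
          ultimately have v: "v \<in> V - S - T" using 2 by blast
          then have "darts v \<subseteq> K" using whole[OF K v] a 2 by blast
          then have "v \<in> base K" using v rest(4)[OF v] unfolding base_def by blast
          then show ?thesis using 2 by blast
        qed
      qed
      show "(\<Union>v\<in>base K. darts v \<union> slots v) \<union> Inl ` (Y1 \<union> Y2) \<subseteq> K"
        using base_sub[OF K] unfolding Y1_def Y2_def by blast
    qed
    have fY: "finite Y1" "finite Y2" using finite_A unfolding Y1_def Y2_def by auto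
    have baseV: "base K \<subseteq> V" unfolding base_def by blast
    have "Inl ` (Y1 \<union> Y2) \<inter> (\<Union>v\<in>base K. darts v \<union> slots v) = {}"
      by (auto simp: Y1_def Y2_def base_def darts_def slots_def)
    moreover have "finite (\<Union>v\<in>base K. darts v \<union> slots v)"
      using base_sub[OF K] fK[OF K] finite_subset by blast
    ultimately have "card K = card (\<Union>v\<in>base K. darts v \<union> slots v)
        + card (Inl ` (Y1 \<union> Y2) :: ('d + 'v \<times> nat) set)"
      using fY by (subst K_eq, subst card_Un_disjoint) auto
    moreover have "card (Inl ` (Y1 \<union> Y2) :: ('d + 'v \<times> nat) set) = card Y1 + card Y2"
      using fY by (subst card_image, simp, subst card_Un_disjoint) (auto simp: Y1_def Y2_def)
    moreover have "even (card Y1)"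
    proof (rule even_card_involution[OF fY(1), of p])
      fix x assume "x \<in> Y1"
      then have x: "x \<in> A" "Inl x \<in> K" "own x \<in> T" "own (p x) \<in> T" unfolding Y1_def by blast+
      have "Inl (p x) \<in> K" using partner[OF K x(1,2)] x(4) ST by blast
      then show "p x \<in> Y1 \<and> p (p x) = x \<and> p x \<noteq> x"
        unfolding Y1_def using x p_in p_p p_neq by simp
    qed
    moreover have "card Y2 = card B"
    proof (rule bij_betw_same_card, rule bij_betwI[where g = p and f = p])
      show "p \<in> Y2 \<rightarrow> B"
      proof
        fix x assume "x \<in> Y2"
        then have x: "x \<in> A" "Inl x \<in> K" "own x \<in> T" "own (p x) \<notin> T" unfolding Y2_def by blast+
        then have "Inl (p x) \<in> K" using partner[OF K x(1,2)] no_TS by blast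
        then have "own (p x) \<in> base K" using dart_in_base[OF K p_in] x by blast
        then show "p x \<in> B" unfolding B_def using x p_in p_p by simp
      qed
      show "p \<in> B \<rightarrow> Y2"
      proof
        fix x assume "x \<in> B"
        then have x: "x \<in> A" "own x \<in> base K" "own (p x) \<in> T" unfolding B_def by blast+
        have "Inl (p x) \<in> K" using partner[OF K x(1) base_dart[OF K x(1,2)]] x(3) ST by blast
        moreover have "own x \<notin> T" using x(2) unfolding base_def by blast
        ultimately show "p x \<in> Y2" unfolding Y2_def using x p_in p_p by simp
      qed
    qed (auto simp: Y2_def B_def p_p)
    ultimately have "odd (card (\<Union>v\<in>base K. darts v \<union> slots v) + card B)"
      using Kodd[OF K] by simp
    then show ?thesis using even_gadget_iff[OF baseV] unfolding B_def by simp
  qed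
  have base_closed: "own (p x) \<in> base K \<union> S \<union> T" if "K \<in> \<K>1" "x \<in> A" "own x \<in> base K" for K x
  proof -
    note K = \<K>1(1)[OF that(1)]
    have "Inl (p x) \<in> K" if "own (p x) \<notin> S"
      using partner[OF K \<open>x \<in> A\<close> base_dart[OF K \<open>x \<in> A\<close> \<open>own x \<in> base K\<close>] that] .
    then show ?thesis using dart_in_base[OF K p_in[OF that(2)]] by blast
  qed

  have base_meet: "K = L" if "K \<in> \<K>1" "L \<in> \<K>1" and meets: "base K \<inter> base L \<noteq> {}" for K L
  proof -
    obtain v where v: "v \<in> base K" "v \<in> base L" using meets by blast
    then obtain a where "a \<in> darts v" using rest(4) unfolding base_def by blast
    then have "a \<in> K" "a \<in> L" using base_sub \<K>1(1) that v by blast+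
    then show ?thesis using disj \<K>1(1) that by blast
  qed
  \<comment> \<open>For an empty base both summands in \<open>odd_base\<close> would be 0.\<close>
  have base_ne: "base K \<noteq> {}" if "K \<in> \<K>1" for K
    using odd_base[OF that] by (intro notI) simp
  have "inj_on base \<K>1" using base_meet base_ne by (intro inj_onI) blast
  then have card_base: "card (base ` \<K>1) = card \<K>1" by (rule card_image)

  have fZ: "finite Z" unfolding Z_def A_TS_def using fS finite_slots finite_A by simp
  have "card (\<K> - \<K>1) \<le> card Z"
  proof (rule card_disjoint_family_meeting_le[OF fZ])
    show "pairwise disjnt (\<K> - \<K>1)"
      using fam unfolding odd_family_def by (blast intro: pairwise_subset)
  qed (auto simp: \<K>1_def)
  moreover have "card \<K> = card (\<K> - \<K>1) + card \<K>1"
    using f\<K> by (subst card_Un_disjoint[symmetric]) (auto simp: \<K>1_def intro: arg_cong[where f = card])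
  moreover have "card Z \<le> (\<Sum>v\<in>S. deg v - f v) + card A_TS"
    unfolding Z_def card_UN_slots[OF SV, symmetric]
    using finite_A by (intro order.trans[OF card_Un_le] add_left_mono card_image_le) (simp add: A_TS_def)
  moreover have "(\<Sum>v\<in>S. deg v) + (\<Sum>v\<in>T. deg v - f v) \<le> card U"
  proof -
    have "(\<Union>v\<in>S. darts v) \<inter> (\<Union>v\<in>T. slots v) = {}" using darts_slots by blast
    then have "(\<Sum>v\<in>S. deg v) + (\<Sum>v\<in>T. deg v - f v) = card ((\<Union>v\<in>S. darts v) \<union> (\<Union>v\<in>T. slots v))"
      unfolding card_UN_darts[OF SV, symmetric] card_UN_slots[OF TV, symmetric]
      using fS fT finite_darts finite_slots by (subst card_Un_disjoint) auto
    also have "\<dots> \<le> card U"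
    proof (rule card_mono)
      show "finite U" using UG finite_gadget finite_subset by blast
      show "(\<Union>v\<in>S. darts v) \<union> (\<Union>v\<in>T. slots v) \<subseteq> U" unfolding S_def T_def by blast
    qed
    finally show ?thesis .
  qed
  moreover have "(\<Sum>v\<in>T. deg v) = card A_TS + card {x \<in> A. own x \<in> T \<and> own (p x) \<notin> S}"
  proof -
    have "(\<Sum>v\<in>T. deg v) = card (\<Union>v\<in>T. {x \<in> A. own x = v})"
      using fT finite_A by (subst card_UN_disjoint) auto
    also have "(\<Union>v\<in>T. {x \<in> A. own x = v}) = A_TS \<union> {x \<in> A. own x \<in> T \<and> own (p x) \<notin> S}"
      unfolding A_TS_def by blast
    also have "card \<dots> = card A_TS + card {x \<in> A. own x \<in> T \<and> own (p x) \<notin> S}"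
      using finite_A by (subst card_Un_disjoint) (auto simp: A_TS_def)
    finally show ?thesis .
  qed
  \<comment> \<open>From \<open>card U + 2 \<le> card \<K>\<close> and
    \<open>card \<K> \<le> card Z + card \<K>1\<close>: the degrees over \<open>S\<close> cancel
    between \<open>U\<close> and \<open>Z\<close>, and subtracting \<open>card A_TS\<close> from the
    degrees over \<open>T\<close> leaves the half-edges not leading to \<open>S\<close>.\<close>
  ultimately have count: "(\<Sum>v\<in>S. f v) + card {x \<in> A. own x \<in> T \<and> own (p x) \<notin> S} + 2
      \<le> card (base ` \<K>1) + (\<Sum>v\<in>T. f v)"
    using card\<K> card_base sum_deg_Diff[OF SV] sum_deg_Diff[OF TV] by linarith
  have "pairwise disjnt (base ` \<K>1)"
    using base_meet unfolding pairwise_def disjnt_def by blast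
  moreover have "\<forall>C\<in>base ` \<K>1. C \<subseteq> V - S - T \<and> (\<forall>x\<in>A. own x \<in> C \<longrightarrow> own (p x) \<in> C \<union> S \<union> T) \<and>
      odd ((\<Sum>v\<in>C. f v) + card {x \<in> A. own x \<in> C \<and> own (p x) \<in> T})"
  proof (rule ballI)
    fix C assume "C \<in> base ` \<K>1"
    then obtain K where K: "K \<in> \<K>1" "C = base K" by blast
    have "base K \<subseteq> V - S - T" unfolding base_def by blast
    then show "C \<subseteq> V - S - T \<and> (\<forall>x\<in>A. own x \<in> C \<longrightarrow> own (p x) \<in> C \<union> S \<union> T) \<and>
      odd ((\<Sum>v\<in>C. f v) + card {x \<in> A. own x \<in> C \<and> own (p x) \<in> T})"
      unfolding K(2) using odd_base[OF K(1)] base_closed[OF K(1)] by blast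
  qed
  ultimately show ?thesis using SV TV ST count by blast
qed

end

section \<open>Barriers for even factors\<close>

text \<open>The barrier for the constant \<open>b\<close> in the graph with loops, translated back.
  The \<open>(b - a) * card T\<close> loop halves at \<open>T\<close> turn \<open>b * card T\<close>
  into \<open>a * card T\<close>; no loop joins a piece to \<open>T\<close>, and \<open>b\<close> is
  even, so the parity condition only sees arcs of \<open>G\<close>.\<close>

lemma even_factor_barrier:
  fixes G :: "('a, 'b) pre_digraph"
  assumes "graph G" and "even a" and "even b" and "a \<le> b"
    and deg: "\<And>v. v \<in> verts G \<Longrightarrow> a \<le> out_degree G v"
    and no_factor: "\<nexists>H. even_factor a b H G"
  shows "\<exists>S T \<C>. S \<subseteq> verts G \<and> T \<subseteq> verts G \<and> S \<inter> T = {} \<and> pairwise disjnt \<C> \<and>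
    (\<forall>C\<in>\<C>. C \<subseteq> verts G - S - T \<and>
      (\<forall>e\<in>arcs G. tail G e \<in> C \<longrightarrow> head G e \<in> C \<union> S \<union> T) \<and>
      odd (card {e \<in> arcs G. tail G e \<in> C \<and> head G e \<in> T})) \<and>
    b * card S + card {e \<in> arcs G. tail G e \<in> T \<and> head G e \<notin> S} + 2 \<le> card \<C> + a * card T"
proof -
  interpret graph G by fact
  \<comment> \<open>A loop adds 2 to the degree, so \<open>l\<close> loops add \<open>b - a\<close>;
    the division is exact because \<open>a\<close> and \<open>b\<close> are even.\<close>
  define l where "l = (b - a) div 2"
  have l: "2 * l = b - a" unfolding l_def using assms(2,3) by simp
  define V where "V = verts G"
  have fV: "finite V" unfolding V_def by simp
  have "\<forall>e\<in>arcs G. \<exists>e'\<in>arcs G. tail G e' = head G e \<and> head G e' = tail G e"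
    using sym_arcs unfolding symmetric_conv by metis
  then obtain rev where rev: "\<And>e. e \<in> arcs G \<Longrightarrow> rev e \<in> arcs G"
      "\<And>e. e \<in> arcs G \<Longrightarrow> tail G (rev e) = head G e" "\<And>e. e \<in> arcs G \<Longrightarrow> head G (rev e) = tail G e"
    by metis
  \<comment> \<open>Without parallel arcs \<open>rev\<close> is an involution; without loops it has
    no fixed point.\<close>
  have rev_rev: "rev (rev e) = e" if "e \<in> arcs G" for e
    using that rev by (intro no_multi_arcs) (auto simp: arc_to_ends_def)
  have rev_neq: "rev e \<noteq> e" if "e \<in> arcs G" for e
    using no_loops[OF that] rev(2)[OF that] by metis
  \<comment> \<open>The Boolean tells the two halves of a loop apart; \<open>p\<close> flips
    it.\<close>
  define loops :: "('a \<times> nat \<times> bool) set" where "loops = V \<times> {..<l} \<times> UNIV"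
  define A :: "('b + 'a \<times> nat \<times> bool) set" where "A = Inl ` arcs G \<union> Inr ` loops"
  define p :: "'b + 'a \<times> nat \<times> bool \<Rightarrow> 'b + 'a \<times> nat \<times> bool"
    where "p = case_sum (\<lambda>e. Inl (rev e)) (\<lambda>(v, i, c). Inr (v, i, \<not> c))"
  define own :: "'b + 'a \<times> nat \<times> bool \<Rightarrow> 'a" where "own = case_sum (tail G) fst"
  have p_simps [simp]: "p (Inl e) = Inl (rev e)" "p (Inr (v, i, c)) = Inr (v, i, \<not> c)"
    and own_simps [simp]: "own (Inl e) = tail G e" "own (Inr y) = fst y" for e v i c y
    unfolding p_def own_def by simp_all
  have fl: "finite loops" unfolding loops_def using fV by simp
  have split: "card {x \<in> A. P x} = card {e \<in> arcs G. P (Inl e)} + card {y \<in> loops. P (Inr y)}" for P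
  proof -
    have "{x \<in> A. P x} = Inl ` {e \<in> arcs G. P (Inl e)} \<union> Inr ` {y \<in> loops. P (Inr y)}"
      unfolding A_def by blast
    moreover have "card (Inl ` {e \<in> arcs G. P (Inl e)} \<union> Inr ` {y \<in> loops. P (Inr y)})
        = card (Inl ` {e \<in> arcs G. P (Inl e)} :: ('b + 'a \<times> nat \<times> bool) set)
        + card (Inr ` {y \<in> loops. P (Inr y)} :: ('b + 'a \<times> nat \<times> bool) set)"
      using fl by (intro card_Un_disjoint) auto
    ultimately show ?thesis by (simp add: card_image)
  qed
  have loops_at: "card {y \<in> loops. fst y \<in> W} = (b - a) * card W" if "W \<subseteq> V" for W
  proof -
    have "{y \<in> loops. fst y \<in> W} = W \<times> {..<l} \<times> UNIV" unfolding loops_def using that by auto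
    then show ?thesis using l by (simp add: card_cartesian_product)
  qed
  have own_arcs: "card {x \<in> A. own x = v} = out_degree G v + (b - a)" if "v \<in> V" for v
    using split[of "\<lambda>x. own x = v"] loops_at[of "{v}"] that
    unfolding out_degree_def out_arcs_def by simp
  have own_p_loop: "own (p (Inr y)) = fst y" for y by (cases y) simp

  interpret D: dart_graph V A p own "\<lambda>_. b"
  proof
    show "finite V" by (rule fV)
    show "finite A" unfolding A_def using fl by simp
    show "own x \<in> V" if "x \<in> A" for x using that unfolding A_def V_def loops_def by auto
    show "p x \<in> A" if "x \<in> A" for x using that rev(1) unfolding A_def loops_def by auto
    show "p (p x) = x" if "x \<in> A" for x using that rev_rev unfolding A_def by auto
    show "p x \<noteq> x" if "x \<in> A" for x using that rev_neq unfolding A_def by auto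
    show "b \<le> card {x \<in> A. own x = v}" if "v \<in> V" for v
      using own_arcs[OF that] deg[of v] that assms(4) unfolding V_def by simp
  qed

  have "\<not> (\<exists>F\<subseteq>A. p ` F \<subseteq> F \<and> (\<forall>v\<in>V. card {x \<in> F. own x = v} = b))"
  proof
    assume "\<exists>F\<subseteq>A. p ` F \<subseteq> F \<and> (\<forall>v\<in>V. card {x \<in> F. own x = v} = b)"
    then obtain F where F: "F \<subseteq> A" "p ` F \<subseteq> F" "\<And>v. v \<in> V \<Longrightarrow> card {x \<in> F. own x = v} = b" by blast
    define H where "H = G\<lparr>arcs := {e \<in> arcs G. Inl e \<in> F}\<rparr>"
    have H_simps [simp]: "verts H = verts G" "tail H = tail G" "head H = head G"
      "arcs H = {e \<in> arcs G. Inl e \<in> F}" unfolding H_def by simp_all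
    have "graph H"
    proof
      show "symmetric H" unfolding symmetric_conv
      proof
        fix e assume "e \<in> arcs H"
        then have e: "e \<in> arcs G" "Inl e \<in> F" by simp_all
        then have "p (Inl e) \<in> F" using F(2) by blast
        then show "\<exists>e'\<in>arcs H. tail H e = head H e' \<and> head H e = tail H e'"
          using rev[OF e(1)] by (intro bexI[of _ "rev e"]) simp_all
      qed
      show "e1 = e2" if "e1 \<in> arcs H" "e2 \<in> arcs H" "arc_to_ends H e1 = arc_to_ends H e2" for e1 e2
        using that no_multi_arcs[of e1 e2] by (simp add: arc_to_ends_def)
    qed (use no_loops in auto)
    moreover have "spanning H G"
      unfolding spanning_def subgraph_def compatible_def
      using wf_digraph graph.axioms(1)[OF \<open>graph H\<close>]
      by (auto simp: digraph_def fin_digraph_def)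
    moreover have "even (out_degree H v) \<and> a \<le> out_degree H v \<and> out_degree H v \<le> b" if v: "v \<in> verts G" for v
    proof -
      \<comment> \<open>The selected loop halves at \<open>v\<close> come in pairs and number at
        most \<open>b - a\<close>, so the remaining degree \<open>b - card L\<close> is even and
        between \<open>a\<close> and \<open>b\<close>.\<close>
      define L where "L = {y \<in> loops. Inr y \<in> F \<and> fst y = v}"
      have "{x \<in> F. own x = v} = {x \<in> A. x \<in> F \<and> own x = v}" using F(1) by blast
      then have sum: "out_degree H v + card L = b"
        using split[of "\<lambda>x. x \<in> F \<and> own x = v"] F(3)[of v] v
        unfolding L_def out_degree_def out_arcs_def V_def by (simp add: conj_assoc)
      have "even (card L)"
      proof (rule even_card_involution[where p = "\<lambda>(v, i, c). (v, i, \<not> c)"])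
        show "finite L" unfolding L_def using fl by simp
        fix y assume y: "y \<in> L"
        obtain w i c where yc: "y = (w, i, c)" by (cases y)
        have "p (Inr y) \<in> F" using y F(2) unfolding L_def by blast
        then show "(case y of (v, i, c) \<Rightarrow> (v, i, \<not> c)) \<in> L \<and>
            (case (case y of (v, i, c) \<Rightarrow> (v, i, \<not> c)) of (v, i, c) \<Rightarrow> (v, i, \<not> c)) = y \<and>
            (case y of (v, i, c) \<Rightarrow> (v, i, \<not> c)) \<noteq> y"
          using y unfolding yc L_def loops_def by auto
      qed
      moreover have "card L \<le> card {y \<in> loops. fst y \<in> {v}}"
        using fl unfolding L_def by (intro card_mono) auto
      moreover have "card {y \<in> loops. fst y \<in> {v}} = b - a"
        using loops_at[of "{v}"] v unfolding V_def by simp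
      moreover have "even (out_degree H v)" using sum calculation(1) assms(3) by (metis even_add)
      ultimately show ?thesis using sum assms(4) by linarith
    qed
    ultimately have "even_factor a b H G" unfolding even_factor_def by blast
    then show False using no_factor by blast
  qed
  moreover have "even (\<Sum>v\<in>V. b)" using assms(3) by simp
  ultimately obtain S T \<C> where ST: "S \<subseteq> V" "T \<subseteq> V" "S \<inter> T = {}" and disj: "pairwise disjnt \<C>"
    and \<C>: "\<And>C. C \<in> \<C> \<Longrightarrow> C \<subseteq> V - S - T" "\<And>C x. C \<in> \<C> \<Longrightarrow> x \<in> A \<Longrightarrow> own x \<in> C \<Longrightarrow> own (p x) \<in> C \<union> S \<union> T"
      "\<And>C. C \<in> \<C> \<Longrightarrow> odd ((\<Sum>v\<in>C. b) + card {x \<in> A. own x \<in> C \<and> own (p x) \<in> T})"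
    and ineq: "(\<Sum>v\<in>S. b) + card {x \<in> A. own x \<in> T \<and> own (p x) \<notin> S} + 2 \<le> card \<C> + (\<Sum>v\<in>T. b)"
    using D.f_factor_barrier by auto
  have "b * card S + card {e \<in> arcs G. tail G e \<in> T \<and> head G e \<notin> S} + 2 \<le> card \<C> + a * card T"
  proof -
    have "{e \<in> arcs G. own (Inl e) \<in> T \<and> own (p (Inl e)) \<notin> S} = {e \<in> arcs G. tail G e \<in> T \<and> head G e \<notin> S}"
      using rev(2) by auto
    moreover have "{y \<in> loops. own (Inr y) \<in> T \<and> own (p (Inr y)) \<notin> S} = {y \<in> loops. fst y \<in> T}"
      using ST(3) own_p_loop by auto
    ultimately have "card {x \<in> A. own x \<in> T \<and> own (p x) \<notin> S}
        = card {e \<in> arcs G. tail G e \<in> T \<and> head G e \<notin> S} + (b - a) * card T"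
      using split[of "\<lambda>x. own x \<in> T \<and> own (p x) \<notin> S"] loops_at[OF ST(2)] by simp
    moreover have "(b - a) * card T + a * card T = b * card T"
      using assms(4) by (metis add_mult_distrib le_add_diff_inverse2)
    ultimately show ?thesis using ineq by (simp add: mult.commute)
  qed
  moreover have "head G e \<in> C \<union> S \<union> T" if "C \<in> \<C>" "e \<in> arcs G" "tail G e \<in> C" for C e
    using \<C>(2)[OF that(1), of "Inl e"] that(2,3) rev(2) unfolding A_def by simp
  moreover have "odd (card {e \<in> arcs G. tail G e \<in> C \<and> head G e \<in> T})" if C: "C \<in> \<C>" for C
  proof -
    have "{e \<in> arcs G. own (Inl e) \<in> C \<and> own (p (Inl e)) \<in> T} = {e \<in> arcs G. tail G e \<in> C \<and> head G e \<in> T}"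
      using rev(2) by auto
    moreover have "{y \<in> loops. own (Inr y) \<in> C \<and> own (p (Inr y)) \<in> T} = {}"
      using \<C>(1)[OF C] own_p_loop by auto
    ultimately have "card {x \<in> A. own x \<in> C \<and> own (p x) \<in> T} = card {e \<in> arcs G. tail G e \<in> C \<and> head G e \<in> T}"
      using split[of "\<lambda>x. own x \<in> C \<and> own (p x) \<in> T"] by (simp only: card.empty add_0_right)
    then show ?thesis using \<C>(3)[OF C] assms(3) by simp
  qed
  ultimately show ?thesis
    using ST disj \<C>(1) unfolding V_def by (intro exI[of _ S] exI[of _ T] exI[of _ \<C>]) blast
qed

section \<open>Degree and connectivity conditions\<close>

text \<open>Here \<open>s\<close>, \<open>t\<close>, \<open>q\<close> stand for the sizes of
  \<open>S\<close>, \<open>T\<close> and the family of pieces, and \<open>D\<close> for the number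
  of arcs from \<open>T\<close> to vertices outside \<open>S\<close>. The barrier and
  \<open>n\<close> bound \<open>s\<close> from above, \<open>deg\<close> and \<open>\<delta>\<close>
  from below; for \<open>0 < h\<close> it is \<open>order\<close> that makes these
  incompatible.\<close>

lemma low_degree_contradiction:
  fixes a b n \<delta> h s t q D :: int
  assumes "4 \<le> a" and "a \<le> b" and deg: "a * n \<le> \<delta> * (a + b)"
    and order: "(a + b)\<^sup>2 - 3 * (a + b) + b \<le> n * b"
    and \<delta>: "\<delta> \<le> h + s" and D: "h * t \<le> D" and barrier: "b * s + D + 2 \<le> q + a * t"
    and qD: "q \<le> D" and n: "s + t + q \<le> n" and nonneg: "0 \<le> h" "0 \<le> q" and "h < a"
  shows False
proof (cases "h = 0")
  case True
  \<comment> \<open>Since \<open>q \<le> D\<close>, the barrier gives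
    \<open>b * s + 2 \<le> a * t\<close>, hence \<open>(a + b) * s + 2 \<le> a * n\<close>.\<close>
  have "\<delta> * (a + b) \<le> s * (a + b)" using \<delta> True assms(1,2) by (intro mult_right_mono) auto
  moreover have "a * t \<le> a * (n - s)" using n nonneg assms(1) by (intro mult_left_mono) auto
  ultimately show False using deg barrier qD by (simp add: algebra_simps)
next
  case False
  define M where "M = a + b"
  have h: "1 \<le> h" using False nonneg by simp
  \<comment> \<open>As \<open>h < a\<close>, \<open>q \<le> (a - h) * q\<close>, so \<open>q\<close>
    and \<open>t\<close> can be bounded together by \<open>n - s\<close>.\<close>
  have "0 \<le> (a - h - 1) * q" using assms(12) nonneg by simp
  moreover have "(a - h) * (t + q) \<le> (a - h) * (n - s)" using n assms(12) by (intro mult_left_mono) auto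
  ultimately have 1: "(M - h) * s + 2 \<le> (a - h) * n"
    using barrier D unfolding M_def by (simp add: algebra_simps)
  have "(M - h) * (\<delta> - h) \<le> (M - h) * s"
    using \<delta> assms(1,2,12) unfolding M_def by (intro mult_left_mono) auto
  with 1 have "M * ((M - h) * (\<delta> - h) + 2) \<le> M * ((a - h) * n)"
    using assms(1,2) unfolding M_def by (intro mult_left_mono) auto
  moreover have "(M - h) * (a * n) \<le> (M - h) * (\<delta> * M)"
    using deg assms(1,2,12) unfolding M_def by (intro mult_left_mono) auto
  ultimately have "(M - h) * (a * n) - M * (M - h) * h + 2 * M \<le> M * ((a - h) * n)"
    by (simp add: algebra_simps)
  then have "h * (n * (M - a)) + M * h\<^sup>2 + 2 * M \<le> h * M\<^sup>2"
    by (simp add: algebra_simps power2_eq_square)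
  moreover have "h * (M\<^sup>2 - 3 * M + b) \<le> h * (n * (M - a))"
    using order h unfolding M_def by (intro mult_left_mono) auto
  ultimately have "M * ((h - 1) * (h - 2)) + h * b \<le> 0"
    by (simp add: algebra_simps power2_eq_square)
  \<comment> \<open>Integrality matters: the product is negative strictly between 1 and 2.\<close>
  moreover have "0 \<le> (h - 1) * (h - 2)"
    using h by (cases "h = 1") auto
  moreover have "0 < h * b" using h assms(1,2) by simp
  moreover have "0 \<le> M" using assms(1,2) unfolding M_def by simp
  ultimately show False using mult_nonneg_nonneg[of M "(h - 1) * (h - 2)"] by linarith
qed

text \<open>With \<open>y = h - a\<close> the barrier gives
  \<open>b * s + y * t + 2 \<le> q\<close>. For \<open>s = 0\<close> this contradicts
  \<open>cut0\<close>; for \<open>0 < s\<close> it makes \<open>t\<close> large, and then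
  \<open>n\<close> exceeds what \<open>deg\<close> and \<open>\<delta>\<close> allow.\<close>

lemma high_degree_contradiction:
  fixes a b n \<delta> h s t q D :: int
  assumes "4 \<le> a" and "a \<le> b" and deg: "a * n \<le> \<delta> * (a + b)"
    and order: "(a + b)\<^sup>2 - 3 * (a + b) + b \<le> n * b"
    and \<delta>: "\<delta> \<le> h + s" and D: "h * t \<le> D" and barrier: "b * s + D + 2 \<le> q + a * t"
    and qD: "q \<le> D" and n: "s + t + q \<le> n" and nonneg: "0 \<le> s" "0 \<le> t" and "a \<le> h"
    and cut: "0 < s \<Longrightarrow> s < a \<Longrightarrow> (a - s) * q \<le> D" and cut0: "s = 0 \<Longrightarrow> (a + 1) * q \<le> D"
  shows False
proof -
  define y where "y = h - a"
  have y: "0 \<le> y" "h = a + y" using assms(12) unfolding y_def by auto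
  have q: "b * s + y * t + 2 \<le> q" using barrier D y by (simp add: algebra_simps)
  have at: "b * s + 2 \<le> a * t" using barrier qD by simp
  have yt: "0 \<le> y * t" using y nonneg by simp
  show False
  proof (cases "s = 0")
    case True
    \<comment> \<open>\<open>\<delta> \<le> a\<close> would force \<open>n \<le> a + b\<close>, too
      small for \<open>order\<close> when \<open>4 \<le> a\<close>. The resulting
      \<open>1 \<le> y\<close> gives \<open>t + 2 \<le> q\<close>, against
      \<open>cut0\<close>.\<close>
    have "a + 1 \<le> \<delta>"
    proof (rule ccontr)
      assume "\<not> a + 1 \<le> \<delta>"
      then have "\<delta> * (a + b) \<le> a * (a + b)" using assms(1,2) by (intro mult_right_mono) auto
      then have "a * n \<le> a * (a + b)" using deg by linarith
      then have "n \<le> a + b" using assms(1) by simp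
      then have "n * b \<le> (a + b) * b" using assms(1,2) by (intro mult_right_mono) auto
      moreover have "4 * (a + b) \<le> a * (a + b)" using assms(1,2) by (intro mult_right_mono) auto
      ultimately show False using order assms(1,2) by (simp add: algebra_simps power2_eq_square)
    qed
    then have "1 \<le> y" using \<delta> True y by simp
    then have "t \<le> y * t" using nonneg mult_right_mono[of 1 y t] by simp
    then have "a * (t + 2) \<le> a * q" using q True assms(1) by (intro mult_left_mono) auto
    moreover have "a * q + 2 \<le> a * t" using cut0[OF True] barrier True by (simp add: algebra_simps)
    ultimately show False using assms(1) by (simp add: algebra_simps)
  next
    case False
    then have s: "1 \<le> s" using nonneg by simp
    \<comment> \<open>For \<open>s < a\<close>, \<open>cut\<close> and the barrier give
      \<open>(a - s) * (b * s + 2) \<le> a * t\<close>, and \<open>a - 1 \<le> (a - s) * s\<close>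
      there; for \<open>a \<le> s\<close> the bound \<open>at\<close> suffices.\<close>
    have key: "(a - 1) * b + 2 \<le> a * t"
    proof (cases "s < a")
      case True
      have "(a - s - 1) * (b * s + 2) \<le> (a - s - 1) * q"
        using q yt True by (intro mult_left_mono) auto
      then have "(a - s) * (b * s + 2) \<le> a * t"
        using cut True s barrier by (simp add: algebra_simps)
      moreover have "0 \<le> b * ((a - s - 1) * (s - 1))" using True s assms(1,2) by simp
      ultimately show ?thesis using True by (simp add: algebra_simps)
    next
      case False
      then have "b * (a - 1) \<le> b * s" using assms(1,2) by (intro mult_left_mono) auto
      then show ?thesis using at by (simp add: algebra_simps)
    qed
    have "4 * b \<le> a * b" using assms(1,2) by (intro mult_right_mono) auto
    moreover have "a * b + 2 \<le> b + a * t" using key by (simp add: algebra_simps)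
    ultimately have atM: "a + b \<le> a * t" using assms(1,2) by linarith
    have "\<delta> * (a + b) \<le> (a + y + s) * (a + b)" using \<delta> y assms(1,2) by (intro mult_right_mono) auto
    moreover have "a * (s + t + (b * s + y * t + 2)) \<le> a * n" using q n assms(1) by (intro mult_left_mono) auto
    ultimately have "a * (s + t + (b * s + y * t + 2)) \<le> (a + y + s) * (a + b)" using deg by linarith
    \<comment> \<open>The terms with \<open>y\<close> are absorbed by
      \<open>a + b \<le> a * t\<close>; the rest reduces to \<open>2 \<le> 0\<close> by
      \<open>1 \<le> s\<close>, \<open>key\<close> and \<open>a \<le> b\<close>.\<close>
    moreover have "y * (a + b) \<le> y * (a * t)" using atM y by (intro mult_left_mono) auto
    moreover have "((a - 1) * b) * 1 \<le> ((a - 1) * b) * s" using s assms(1,2) by (intro mult_left_mono) auto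
    moreover have "a * (a - 2) \<le> b * (a - 2)" using assms(1,2) by (intro mult_right_mono) auto
    ultimately show False using key by (simp add: algebra_simps)
  qed
qed

section \<open>Vertex connectivity and separating sets\<close>

lemma connected_closed_eq_verts:
  assumes "Digraph_Component.connected H" and "C \<subseteq> verts H" and "C \<noteq> {}"
    and closed: "\<And>e. e \<in> arcs H \<Longrightarrow> tail H e \<in> C \<longleftrightarrow> head H e \<in> C"
  shows "C = verts H"
proof -
  obtain u where u: "u \<in> C" using assms(3) by blast
  \<comment> \<open>Connectivity means reachability in the symmetric closure, and no step of that
    closure leaves \<open>C\<close>.\<close>
  have "v \<in> C" if v: "v \<in> verts H" for v
  proof -
    let ?M = "with_proj (mk_symmetric H)"
    have "u \<rightarrow>\<^sup>*\<^bsub>?M\<^esub> v"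
      using assms(1,2) u v unfolding Digraph_Component.connected_def strongly_connected_def mk_symmetric_def
      by auto
    then have "(u, v) \<in> rtrancl_on (verts ?M) (arcs_ends ?M)" unfolding reachable_def .
    then show "v \<in> C"
    proof (induction rule: rtrancl_on_induct)
      case base
      show ?case by (rule u)
    next
      case (step y z)
      then have "(y, z) \<in> parcs (mk_symmetric H)" by (simp add: arcs_ends_conv)
      then obtain e where "e \<in> arcs H" "y = tail H e \<and> z = head H e \<or> y = head H e \<and> z = tail H e"
        unfolding mk_symmetric_def by auto
      then show ?case using closed \<open>y \<in> C\<close> by blast
    qed
  qed
  then show ?thesis using assms(2) by blast
qed

lemma connected_of_vertex_connectivity:
  assumes "finite (verts G)" and "vertex_connectivity G \<ge> a" and "S \<subseteq> verts G" and "card S < a"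
  shows "Digraph_Component.connected (G \<restriction> (verts G - S))"
proof -
  define X where "X = {k. card (verts G) \<ge> k + 1 \<and>
      (\<forall>S \<subseteq> verts G. card S < k \<longrightarrow> Digraph_Component.connected (G \<restriction> (verts G - S)))}"
  have Sup_X: "vertex_connectivity G = Sup X" unfolding vertex_connectivity_def X_def ..
  \<comment> \<open>The supremum of the empty set of naturals is 0, but \<open>card S < a\<close>
    makes the connectivity positive.\<close>
  have "X \<noteq> {}" using Sup_X assms(2,4) by (intro notI) (simp add: Sup_nat_def)
  moreover have "finite X" by (rule finite_subset[of _ "{..card (verts G)}"]) (auto simp: X_def)
  ultimately have "vertex_connectivity G \<in> X" using Max_in[of X] unfolding Sup_X Sup_nat_def by simp
  then show ?thesis using assms(2-4) unfolding X_def by simp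
qed


text \<open>\<open>S\<close> together with the ends in \<open>T\<close> of the arcs from
  \<open>C\<close> separates \<open>C\<close> from \<open>w\<close>, which lies outside
  \<open>T\<close>; hence it has at least \<open>a\<close> vertices.\<close>

lemma card_arcs_between_ge:
  assumes "graph G" and conn: "vertex_connectivity G \<ge> a"
    and S: "S \<subseteq> verts G" and T: "T \<subseteq> verts G" and C: "C \<subseteq> verts G - S - T" "C \<noteq> {}"
    and closed: "\<And>e. e \<in> arcs G \<Longrightarrow> tail G e \<in> C \<Longrightarrow> head G e \<in> C \<union> S \<union> T"
    and other: "w \<in> verts G - S - T" "w \<notin> C"
  shows "a \<le> card S + card {e \<in> arcs G. tail G e \<in> C \<and> head G e \<in> T}"
proof (rule ccontr)
  interpret graph G by fact
  let ?B = "{e \<in> arcs G. tail G e \<in> C \<and> head G e \<in> T}"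
  assume "\<not> a \<le> card S + card ?B"
  moreover have "card (S \<union> head G ` ?B) \<le> card S + card ?B"
    using card_Un_le[of S "head G ` ?B"] card_image_le[of ?B "head G"] by simp
  ultimately have "card (S \<union> head G ` ?B) < a" by linarith
  moreover have "S \<union> head G ` ?B \<subseteq> verts G" using S T by blast
  ultimately have "Digraph_Component.connected (G \<restriction> (verts G - (S \<union> head G ` ?B)))"
    using connected_of_vertex_connectivity[OF _ conn] by simp
  then have "C = verts (G \<restriction> (verts G - (S \<union> head G ` ?B)))"
  proof (rule connected_closed_eq_verts)
    show "C \<subseteq> verts (G \<restriction> (verts G - (S \<union> head G ` ?B)))" using C by auto
    have fwd: "head G e \<in> C"
      if "e \<in> arcs G" "tail G e \<in> C" "head G e \<notin> S \<union> head G ` ?B" for e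
      using closed[OF that(1,2)] that by blast
    fix e assume "e \<in> arcs (G \<restriction> (verts G - (S \<union> head G ` ?B)))"
    then have e: "e \<in> arcs G" "tail G e \<notin> S \<union> head G ` ?B" "head G e \<notin> S \<union> head G ` ?B" by auto
    obtain e' where e': "e' \<in> arcs G" "tail G e' = head G e" "head G e' = tail G e"
      using sym_arcs e(1) unfolding symmetric_conv by metis
    show "tail (G \<restriction> (verts G - (S \<union> head G ` ?B))) e \<in> C
        \<longleftrightarrow> head (G \<restriction> (verts G - (S \<union> head G ` ?B))) e \<in> C"
      using fwd[of e] fwd[of e'] e e' by auto
  qed (rule C(2))
  moreover have "w \<in> verts G - (S \<union> head G ` ?B)" using other(1) by auto
  ultimately show False using other(2) by simp
qed

section \<open>The barrier against the order, degree and connectivity hypotheses\<close>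

theorem mainTheorem1:
  fixes G :: "('a, 'b) pre_digraph" and a b n :: nat
  assumes "even a" and "even b" and "4 \<le> a" and "a \<le> b"
    and "graph G" and "card (verts G) = n"
    and "vertex_connectivity G \<ge> a"
    and "real n \<ge> 2 * real a + real b + ((real a)\<^sup>2 - 3 * real a) / real b - 2"
    and "real (min_degree G) \<ge> real a * real n / (real a + real b)"
  shows "\<exists>H. even_factor a b H G"
proof (rule ccontr)
  assume no_factor: "\<nexists>H. even_factor a b H G"
  interpret graph G by fact
  define \<delta> where "\<delta> = min_degree G"
  have "real a * real n \<le> real \<delta> * (real a + real b)"
    using assms(3,9) unfolding \<delta>_def by (simp add: divide_simps split: if_splits)
  then have "real (a * n) \<le> real (\<delta> * (a + b))" by simp
  then have deg: "a * n \<le> \<delta> * (a + b)" by (simp only: of_nat_le_iff)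
  \<comment> \<open>The condition on \<open>n\<close> multiplied by \<open>b\<close> and rewritten
    in powers of \<open>a + b\<close>.\<close>
  have "(2 * real a + real b + ((real a)\<^sup>2 - 3 * real a) / real b - 2) * real b \<le> real n * real b"
    using assms(8) by (intro mult_right_mono) auto
  moreover have "((real a)\<^sup>2 - 3 * real a) / real b * real b = (real a)\<^sup>2 - 3 * real a"
    using assms(3,4) by simp
  ultimately have "real_of_int ((int a + int b)\<^sup>2 - 3 * (int a + int b) + int b) \<le> real_of_int (int n * int b)"
    by (simp add: algebra_simps power2_eq_square)
  then have order: "(int a + int b)\<^sup>2 - 3 * (int a + int b) + int b \<le> int n * int b"
    by (simp only: of_int_le_iff)
  have min_deg: "\<delta> \<le> out_degree G v" if "v \<in> verts G" for v
    unfolding \<delta>_def min_degree_def using that by (intro Min_le) auto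
  \<comment> \<open>\<open>order\<close> yields \<open>a + b \<le> n\<close>, and then the degree
    condition yields \<open>a \<le> \<delta>\<close>.\<close>
  have a_le: "a \<le> out_degree G v" if v: "v \<in> verts G" for v
  proof -
    have "int b * (int a + int b) \<le> (int a + int b)\<^sup>2 - 3 * (int a + int b) + int b"
    proof -
      have "0 \<le> (int a + int b) * (int a - 3)" using assms(3) by simp
      then show ?thesis by (simp add: algebra_simps power2_eq_square)
    qed
    then have "int b * (int a + int b) \<le> int b * int n" using order by (simp add: mult.commute)
    then have "a + b \<le> n" using assms(3,4) by simp
    then have "a * (a + b) \<le> \<delta> * (a + b)" using deg by (meson le_trans mult_le_mono2)
    then have "a \<le> \<delta>" using assms(3) by simp
    then show ?thesis using min_deg[OF v] by simp
  qed
  obtain S T \<C> where ST: "S \<subseteq> verts G" "T \<subseteq> verts G" "S \<inter> T = {}" and disj: "pairwise disjnt \<C>"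
    and \<C>sub: "\<And>C. C \<in> \<C> \<Longrightarrow> C \<subseteq> verts G - S - T"
    and \<C>closed: "\<And>C e. C \<in> \<C> \<Longrightarrow> e \<in> arcs G \<Longrightarrow> tail G e \<in> C \<Longrightarrow> head G e \<in> C \<union> S \<union> T"
    and \<C>odd: "\<And>C. C \<in> \<C> \<Longrightarrow> odd (card {e \<in> arcs G. tail G e \<in> C \<and> head G e \<in> T})"
    and barrier: "b * card S + card {e \<in> arcs G. tail G e \<in> T \<and> head G e \<notin> S} + 2
      \<le> card \<C> + a * card T"
    using even_factor_barrier[OF assms(5,1,2,4) a_le no_factor] by auto
  define s t q D where "s = card S" and "t = card T" and "q = card \<C>"
    and "D = card {e \<in> arcs G. tail G e \<in> T \<and> head G e \<notin> S}"
  have fS: "finite S" and fT: "finite T" using finite_subset[OF ST(1)] finite_subset[OF ST(2)] by simp_all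
  have \<C>ne: "C \<noteq> {}" if "C \<in> \<C>" for C using \<C>odd[OF that] by auto
  have f\<C>: "finite \<C>" by (rule finite_subset[of _ "Pow (verts G)"]) (use \<C>sub in auto)

  \<comment> \<open>Pieces are disjoint, and reversal maps the arcs from pieces to \<open>T\<close>
    injectively into those counted by \<open>D\<close>. Applied with \<open>k\<close> equal to 1,
    \<open>a - s\<close> and \<open>a + 1\<close>.\<close>
  have D_ge: "k * q \<le> D" if "\<And>C. C \<in> \<C> \<Longrightarrow> k \<le> card {e \<in> arcs G. tail G e \<in> C \<and> head G e \<in> T}" for k
  proof -
    have "k * q \<le> (\<Sum>C\<in>\<C>. card {e \<in> arcs G. tail G e \<in> C \<and> head G e \<in> T})"
      using sum_mono[of \<C> "\<lambda>_. k"] that unfolding q_def by (simp add: mult.commute)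
    also have "\<dots> = card (\<Union>C\<in>\<C>. {e \<in> arcs G. tail G e \<in> C \<and> head G e \<in> T})"
      using disj f\<C> by (subst card_UN_disjoint) (auto simp: pairwise_def disjnt_def)
    also have "\<dots> \<le> card (arc_to_ends G ` {e \<in> arcs G. tail G e \<in> T \<and> head G e \<notin> S})"
    proof (rule card_inj_on_le[of "\<lambda>e. (head G e, tail G e)"])
      show "inj_on (\<lambda>e. (head G e, tail G e)) (\<Union>C\<in>\<C>. {e \<in> arcs G. tail G e \<in> C \<and> head G e \<in> T})"
        using no_multi_arcs by (auto intro!: inj_onI simp: arc_to_ends_def)
      show "(\<lambda>e. (head G e, tail G e)) ` (\<Union>C\<in>\<C>. {e \<in> arcs G. tail G e \<in> C \<and> head G e \<in> T})
          \<subseteq> arc_to_ends G ` {e \<in> arcs G. tail G e \<in> T \<and> head G e \<notin> S}"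
      proof (clarify)
        fix C e assume e: "C \<in> \<C>" "e \<in> arcs G" "tail G e \<in> C" "head G e \<in> T"
        obtain e' where e': "e' \<in> arcs G" "tail G e' = head G e" "head G e' = tail G e"
          using sym_arcs e(2) unfolding symmetric_conv by metis
        then show "(head G e, tail G e) \<in> arc_to_ends G ` {e \<in> arcs G. tail G e \<in> T \<and> head G e \<notin> S}"
          using e \<C>sub[OF e(1)] by (intro image_eqI[of _ _ e']) (auto simp: arc_to_ends_def)
      qed
    qed simp
    also have "\<dots> \<le> D" unfolding D_def by (rule card_image_le) simp
    finally show ?thesis .
  qed
  have qD: "q \<le> D"
    using D_ge[of 1] \<C>odd by (metis One_nat_def Suc_leI mult_1 odd_pos)
  have n: "s + t + q \<le> n"
  proof -
    have "q \<le> card (verts G - S - T)" unfolding q_def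
    proof (rule card_disjoint_family_meeting_le[OF _ disj])
      show "C \<inter> (verts G - S - T) \<noteq> {}" if "C \<in> \<C>" for C using \<C>sub[OF that] \<C>ne[OF that] by blast
    qed simp
    moreover have "verts G - S - T = verts G - (S \<union> T)" by blast
    moreover have "card (verts G - (S \<union> T)) + card (S \<union> T) = card (verts G)"
      using ST card_Diff_subset[of "S \<union> T" "verts G"] card_mono[of "verts G" "S \<union> T"] fS fT
      by simp
    moreover have "card (S \<union> T) = s + t" unfolding s_def t_def using fS fT ST(3) by (rule card_Un_disjoint)
    ultimately show ?thesis using assms(6) by simp
  qed

  define d where "d v = card {e \<in> arcs G. tail G e = v \<and> head G e \<notin> S}" for v
  \<comment> \<open>An empty \<open>T\<close> would give \<open>q \<le> D = 0\<close>, and the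
    barrier would read \<open>b * s + 2 \<le> 0\<close>.\<close>
  have "T \<noteq> {}"
  proof
    assume "T = {}"
    then have "t = 0" "D = 0" unfolding t_def D_def by simp_all
    then show False using barrier qD unfolding s_def[symmetric] t_def[symmetric] q_def[symmetric] by simp
  qed
  define h where "h = Min (d ` T)"
  have "h \<in> d ` T" unfolding h_def using fT \<open>T \<noteq> {}\<close> by (intro Min_in) auto
  then obtain v where v: "v \<in> T" "h = d v" by blast
  have D: "h * t \<le> D"
  proof -
    have "h * t \<le> (\<Sum>v\<in>T. d v)"
      using sum_mono[of T "\<lambda>_. h" d] fT unfolding t_def h_def by (simp add: mult.commute)
    also have "\<dots> = card (\<Union>v\<in>T. {e \<in> arcs G. tail G e = v \<and> head G e \<notin> S})"
      unfolding d_def using fT by (subst card_UN_disjoint) auto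
    also have "(\<Union>v\<in>T. {e \<in> arcs G. tail G e = v \<and> head G e \<notin> S}) = {e \<in> arcs G. tail G e \<in> T \<and> head G e \<notin> S}"
      by blast
    finally show ?thesis unfolding D_def .
  qed
  have \<delta>: "\<delta> \<le> h + s"
  proof -
    have "\<delta> \<le> card {e \<in> arcs G. tail G e = v}"
      using min_deg[of v] v(1) ST(2) unfolding out_degree_def out_arcs_def by blast
    also have "\<dots> \<le> card ({e \<in> arcs G. tail G e = v \<and> head G e \<notin> S} \<union> {e \<in> arcs G. tail G e = v \<and> head G e \<in> S})"
      by (intro card_mono) auto
    also have "\<dots> \<le> h + card {e \<in> arcs G. tail G e = v \<and> head G e \<in> S}"
      unfolding v(2) d_def by (rule card_Un_le)
    also have "card {e \<in> arcs G. tail G e = v \<and> head G e \<in> S} \<le> s" unfolding s_def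
      using fS no_multi_arcs
      by (intro card_inj_on_le[of "head G"]) (auto intro!: inj_onI simp: arc_to_ends_def)
    finally show ?thesis by simp
  qed
  have barrier': "b * s + D + 2 \<le> q + a * t" using barrier unfolding s_def t_def q_def D_def .

  have ints: "4 \<le> int a" "int a \<le> int b" "int a * int n \<le> int \<delta> * (int a + int b)"
    "int \<delta> \<le> int h + int s" "int h * int t \<le> int D" "int b * int s + int D + 2 \<le> int q + int a * int t"
    "int q \<le> int D" "int s + int t + int q \<le> int n"
    using of_nat_mono[OF assms(3), where 'a = int] of_nat_mono[OF assms(4), where 'a = int]
      of_nat_mono[OF deg, where 'a = int] of_nat_mono[OF \<delta>, where 'a = int]
      of_nat_mono[OF D, where 'a = int] of_nat_mono[OF barrier', where 'a = int]
      of_nat_mono[OF qD, where 'a = int] of_nat_mono[OF n, where 'a = int]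
    unfolding of_nat_mult of_nat_add of_nat_numeral .
  show False
  proof (cases "h < a")
    case True
    then show False using low_degree_contradiction[OF ints(1-3) order ints(4-8)] by simp
  next
    case False
    then have "a * t \<le> D" using D by (meson le_trans mult_le_mono1 not_le)
    \<comment> \<open>A second piece supplies the vertex \<open>w\<close> to be separated from
      \<open>C\<close>.\<close>
    then have q2: "2 \<le> q" using barrier' by linarith
    have cut: "a - s \<le> card {e \<in> arcs G. tail G e \<in> C \<and> head G e \<in> T}" if C: "C \<in> \<C>" for C
    proof -
      have "\<C> \<noteq> {C}" using q2 unfolding q_def by auto
      then obtain C' where C': "C' \<in> \<C>" "C' \<noteq> C" using C by blast
      then obtain w where "w \<in> C'" using \<C>ne by blast
      moreover have "C \<inter> C' = {}" using disj C C' unfolding pairwise_def disjnt_def by blast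
      ultimately have w: "w \<in> verts G - S - T" "w \<notin> C" using \<C>sub C' by blast+
      show ?thesis
        using card_arcs_between_ge[OF assms(5,7) ST(1,2) \<C>sub[OF C] \<C>ne[OF C] \<C>closed[OF C] w]
        unfolding s_def by simp
    qed
    show False
    proof (rule high_degree_contradiction[OF ints(1-3) order ints(4-8)])
      show "int a \<le> int h" using False by simp
      show "(int a - int s) * int q \<le> int D" if "int s < int a"
      proof -
        have "int ((a - s) * q) \<le> int D" using D_ge[of "a - s"] cut by (simp only: of_nat_le_iff)
        then show ?thesis using that by (simp add: of_nat_diff)
      qed
      show "(int a + 1) * int q \<le> int D" if "int s = 0"
      proof -
        \<comment> \<open>With \<open>s = 0\<close> at least \<open>a\<close> arcs go from
          \<open>C\<close> to \<open>T\<close>, and their number is odd while \<open>a\<close> is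
          even.\<close>
        have "a + 1 \<le> card {e \<in> arcs G. tail G e \<in> C \<and> head G e \<in> T}" if "C \<in> \<C>" for C
        proof -
          have "a \<le> card {e \<in> arcs G. tail G e \<in> C \<and> head G e \<in> T}"
            using cut[OF that] \<open>int s = 0\<close> by simp
          moreover have "a \<noteq> card {e \<in> arcs G. tail G e \<in> C \<and> head G e \<in> T}"
            using \<C>odd[OF that] assms(1) by metis
          ultimately show ?thesis by linarith
        qed
        then have "int ((a + 1) * q) \<le> int D" using D_ge[of "a + 1"] by (simp only: of_nat_le_iff)
        then show ?thesis by (simp add: algebra_simps)
      qed
    qed simp_all
  qed
qed

end
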